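(* Let $E$ and $F$ be graphs. If $L_{\mathbb{C}}(E) \cong L_{\mathbb{C}}(F)$ (as $*$-algebras), then $C^*(E) \cong C^*(F)$ (as $*$-algebras).
   Context: A graph $E=(E^0,E^1,r,s)$ consists of a countable set $E^0$ of vertices, a countable set $E^1$ of edges, and maps $r,s:E^1\to E^0$ (range and source). A vertex $v$ is regular if $0<|s^{-1}(v)|<\infty$. $C^*(E)$ is the universal $C^*$-algebra generated by mutually orthogonal projections $\{p_v:v\in E^0\}$ and partial isometries $\{s_e:e\in E^1\}$ with mutually orthogonal ranges ($s_e^*s_f=0$ for $e\ne f$) satisfying $s_e^*s_e=p_{r(e)}$ and $s_es_e^*\le p_{s(e)}$ for all $e\in E^1$, and $p_v=\sum_{s(e)=v}s_es_e^*$ for every regular vertex $v$. $L_{\mathbb{C}}(E)$ (the Leavitt path algebra) is the (not necessarily unital) associative $\mathbb{C}$-algebra generated by pairwise orthogonal idempotents $\{v:v\in E^0\}$ and elements $\{e,e^*:e\in E^1\}$ subject to $s(e)e=er(e)=e$, $r(e)e^*=e^*s(e)=e^*$, $e^*f=\delta_{e,f}\,r(e)$ for $e,f\in E^1$, and $v=\sum_{s(e)=v}ee^*$ for every regular vertex $v$. It is a $*$-algebra under the conjugate-linear, product-reversing involution with $v^*=v$ and $e\mapsto e^*$. Isomorphic "as $*$-algebras" means via a $\mathbb{C}$-linear, multiplicative, $*$-preserving bijection. *)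

theory Defs
  imports
    Complex_Main
    "HOL-Library.Countable_Set"
    "HOL-Library.Poly_Mapping"
    "HOL-Algebra.Module"
    "Graph_Theory.Digraph"
begin

section \<open>Complex \<open>*\<close>-algebras\<close>

text \<open>
  Algebras are not assumed to be unital.  The record field \<open>one\<close> is inherited from
  the ring records of the library, but plays no role.
\<close>

record 'a star_algebra = "(complex, 'a) module" +
  adj :: "'a \<Rightarrow> 'a"

record 'a normed_star_algebra = "'a star_algebra" +
  alg_norm :: "'a \<Rightarrow> real"

locale star_algebra = abelian_group A for A (structure) +
  assumes mult_closed: "\<lbrakk>x \<in> carrier A; y \<in> carrier A\<rbrakk> \<Longrightarrow> x \<otimes> y \<in> carrier A"
    and mult_assoc: "\<lbrakk>x \<in> carrier A; y \<in> carrier A; z \<in> carrier A\<rbrakk>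
      \<Longrightarrow> (x \<otimes> y) \<otimes> z = x \<otimes> (y \<otimes> z)"
    and distrib_right: "\<lbrakk>x \<in> carrier A; y \<in> carrier A; z \<in> carrier A\<rbrakk>
      \<Longrightarrow> (x \<oplus> y) \<otimes> z = x \<otimes> z \<oplus> y \<otimes> z"
    and distrib_left: "\<lbrakk>x \<in> carrier A; y \<in> carrier A; z \<in> carrier A\<rbrakk>
      \<Longrightarrow> x \<otimes> (y \<oplus> z) = x \<otimes> y \<oplus> x \<otimes> z"
    and smult_closed: "x \<in> carrier A \<Longrightarrow> c \<odot> x \<in> carrier A"
    and smult_add_right: "\<lbrakk>x \<in> carrier A; y \<in> carrier A\<rbrakk> \<Longrightarrow> c \<odot> (x \<oplus> y) = c \<odot> x \<oplus> c \<odot> y"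
    and smult_add_left: "x \<in> carrier A \<Longrightarrow> (c + d) \<odot> x = c \<odot> x \<oplus> d \<odot> x"
    and smult_assoc: "x \<in> carrier A \<Longrightarrow> (c * d) \<odot> x = c \<odot> (d \<odot> x)"
    and smult_one: "x \<in> carrier A \<Longrightarrow> 1 \<odot> x = x"
    and smult_mult_left: "\<lbrakk>x \<in> carrier A; y \<in> carrier A\<rbrakk> \<Longrightarrow> (c \<odot> x) \<otimes> y = c \<odot> (x \<otimes> y)"
    and smult_mult_right: "\<lbrakk>x \<in> carrier A; y \<in> carrier A\<rbrakk> \<Longrightarrow> x \<otimes> (c \<odot> y) = c \<odot> (x \<otimes> y)"
    and adj_closed: "x \<in> carrier A \<Longrightarrow> adj A x \<in> carrier A"
    and adj_adj: "x \<in> carrier A \<Longrightarrow> adj A (adj A x) = x"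
    and adj_add: "\<lbrakk>x \<in> carrier A; y \<in> carrier A\<rbrakk> \<Longrightarrow> adj A (x \<oplus> y) = adj A x \<oplus> adj A y"
    and adj_smult: "x \<in> carrier A \<Longrightarrow> adj A (c \<odot> x) = cnj c \<odot> adj A x"
    and adj_mult: "\<lbrakk>x \<in> carrier A; y \<in> carrier A\<rbrakk> \<Longrightarrow> adj A (x \<otimes> y) = adj A y \<otimes> adj A x"

definition star_hom ::
  "('a, 'm) star_algebra_scheme \<Rightarrow> ('b, 'n) star_algebra_scheme \<Rightarrow> ('a \<Rightarrow> 'b) \<Rightarrow> bool" where
  "star_hom A B \<phi> \<longleftrightarrow>
     (\<forall>x\<in>carrier A. \<phi> x \<in> carrier B) \<and>
     (\<forall>x\<in>carrier A. \<forall>y\<in>carrier A. \<phi> (x \<oplus>\<^bsub>A\<^esub> y) = \<phi> x \<oplus>\<^bsub>B\<^esub> \<phi> y) \<and>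
     (\<forall>c. \<forall>x\<in>carrier A. \<phi> (c \<odot>\<^bsub>A\<^esub> x) = c \<odot>\<^bsub>B\<^esub> \<phi> x) \<and>
     (\<forall>x\<in>carrier A. \<forall>y\<in>carrier A. \<phi> (x \<otimes>\<^bsub>A\<^esub> y) = \<phi> x \<otimes>\<^bsub>B\<^esub> \<phi> y) \<and>
     (\<forall>x\<in>carrier A. \<phi> (adj A x) = adj B (\<phi> x))"

definition star_isomorphic ::
  "('a, 'm) star_algebra_scheme \<Rightarrow> ('b, 'n) star_algebra_scheme \<Rightarrow> bool" where
  "star_isomorphic A B \<longleftrightarrow> (\<exists>\<phi>. star_hom A B \<phi> \<and> bij_betw \<phi> (carrier A) (carrier B))"

text \<open>The operations are independent of representatives if \<open>r\<close> is a congruence.\<close>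

definition quot_star_algebra ::
  "('a, 'm) star_algebra_scheme \<Rightarrow> ('a \<times> 'a) set \<Rightarrow> 'a set star_algebra" where
  "quot_star_algebra A r =
     \<lparr>carrier = carrier A // r,
      mult = (\<lambda>X Y. \<Union>x\<in>X. \<Union>y\<in>Y. r `` {x \<otimes>\<^bsub>A\<^esub> y}),
      one = undefined,
      zero = r `` {\<zero>\<^bsub>A\<^esub>},
      add = (\<lambda>X Y. \<Union>x\<in>X. \<Union>y\<in>Y. r `` {x \<oplus>\<^bsub>A\<^esub> y}),
      smult = (\<lambda>c X. \<Union>x\<in>X. r `` {c \<odot>\<^bsub>A\<^esub> x}),
      adj = (\<lambda>X. \<Union>x\<in>X. r `` {adj A x})\<rparr>"


section \<open>\<open>C\<^sup>*\<close>-algebras and completions\<close>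

definition cstar_seminorm :: "('a, 'm) star_algebra_scheme \<Rightarrow> ('a \<Rightarrow> real) \<Rightarrow> bool" where
  "cstar_seminorm A q \<longleftrightarrow>
     (\<forall>x\<in>carrier A. 0 \<le> q x) \<and>
     (\<forall>x\<in>carrier A. \<forall>y\<in>carrier A. q (x \<oplus>\<^bsub>A\<^esub> y) \<le> q x + q y) \<and>
     (\<forall>c. \<forall>x\<in>carrier A. q (c \<odot>\<^bsub>A\<^esub> x) = cmod c * q x) \<and>
     (\<forall>x\<in>carrier A. \<forall>y\<in>carrier A. q (x \<otimes>\<^bsub>A\<^esub> y) \<le> q x * q y) \<and>
     (\<forall>x\<in>carrier A. q (adj A x \<otimes>\<^bsub>A\<^esub> x) = (q x)\<^sup>2)"

definition cauchy_in :: "('a, 'm) star_algebra_scheme \<Rightarrow> ('a \<Rightarrow> real) \<Rightarrow> (nat \<Rightarrow> 'a) \<Rightarrow> bool" where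
  "cauchy_in A q X \<longleftrightarrow> (\<forall>n. X n \<in> carrier A) \<and>
     (\<forall>\<epsilon>>0. \<exists>M. \<forall>m\<ge>M. \<forall>n\<ge>M. q (X m \<ominus>\<^bsub>A\<^esub> X n) < \<epsilon>)"

definition converges_in ::
  "('a, 'm) star_algebra_scheme \<Rightarrow> ('a \<Rightarrow> real) \<Rightarrow> (nat \<Rightarrow> 'a) \<Rightarrow> 'a \<Rightarrow> bool" where
  "converges_in A q X l \<longleftrightarrow> (\<lambda>n. q (X n \<ominus>\<^bsub>A\<^esub> l)) \<longlonglongrightarrow> 0"

locale cstar_algebra = star_algebra A for A (structure) +
  assumes norm_cstar: "cstar_seminorm A (alg_norm A)"
    and norm_definite: "\<lbrakk>x \<in> carrier A; alg_norm A x = 0\<rbrakk> \<Longrightarrow> x = \<zero>"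
    and complete: "cauchy_in A (alg_norm A) X \<Longrightarrow> \<exists>l\<in>carrier A. converges_in A (alg_norm A) X l"

definition cauchy_algebra ::
  "('a, 'm) star_algebra_scheme \<Rightarrow> ('a \<Rightarrow> real) \<Rightarrow> (nat \<Rightarrow> 'a) star_algebra" where
  "cauchy_algebra A q =
     \<lparr>carrier = {X. cauchy_in A q X},
      mult = (\<lambda>X Y n. X n \<otimes>\<^bsub>A\<^esub> Y n),
      one = undefined,
      zero = (\<lambda>n. \<zero>\<^bsub>A\<^esub>),
      add = (\<lambda>X Y n. X n \<oplus>\<^bsub>A\<^esub> Y n),
      smult = (\<lambda>c X n. c \<odot>\<^bsub>A\<^esub> X n),
      adj = (\<lambda>X n. adj A (X n))\<rparr>"

definition null_rel ::
  "('a, 'm) star_algebra_scheme \<Rightarrow> ('a \<Rightarrow> real) \<Rightarrow> ((nat \<Rightarrow> 'a) \<times> (nat \<Rightarrow> 'a)) set" where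
  "null_rel A q = {(X, Y). cauchy_in A q X \<and> cauchy_in A q Y \<and> (\<lambda>n. q (X n \<ominus>\<^bsub>A\<^esub> Y n)) \<longlonglongrightarrow> 0}"

text \<open>
  The Hausdorff completion of a \<open>*\<close>-algebra for a \<open>C\<^sup>*\<close>-seminorm \<open>q\<close>, as Cauchy
  sequences modulo null sequences.  It is a \<open>C\<^sup>*\<close>-algebra by
  \<open>completion_cstar_algebra\<close> below.
\<close>

definition cstar_completion ::
  "('a, 'm) star_algebra_scheme \<Rightarrow> ('a \<Rightarrow> real) \<Rightarrow> (nat \<Rightarrow> 'a) set normed_star_algebra" where
  "cstar_completion A q =
     star_algebra.extend (quot_star_algebra (cauchy_algebra A q) (null_rel A q))
       \<lparr>alg_norm = (\<lambda>\<X>. THE l. \<forall>X\<in>\<X>. (\<lambda>n. q (X n)) \<longlonglongrightarrow> l)\<rparr>"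

definition completion_map ::
  "('a, 'm) star_algebra_scheme \<Rightarrow> ('a \<Rightarrow> real) \<Rightarrow> 'a \<Rightarrow> (nat \<Rightarrow> 'a) set" where
  "completion_map A q x = null_rel A q `` {\<lambda>n. x}"


section \<open>Directed graphs\<close>

text \<open>
  The source and the range of an edge are its \<open>tail\<close> and its \<open>head\<close>; loops and
  multiple edges are allowed.
\<close>

locale countable_digraph = wf_digraph E for E (structure) +
  assumes countable_verts: "countable (verts E)"
    and countable_arcs: "countable (arcs E)"

definition regular_vertex :: "('v, 'e) pre_digraph \<Rightarrow> 'v \<Rightarrow> bool" where
  "regular_vertex E v \<longleftrightarrow> v \<in> verts E \<and> out_arcs E v \<noteq> {} \<and> finite (out_arcs E v)"


section \<open>The free \<open>*\<close>-algebra on a graph\<close>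

datatype ('v, 'e) generator = Vertex 'v | Edge 'e | Ghost 'e

fun generator_star :: "('v, 'e) generator \<Rightarrow> ('v, 'e) generator" where
  "generator_star (Vertex v) = Vertex v"
| "generator_star (Edge e) = Ghost e"
| "generator_star (Ghost e) = Edge e"

definition generators :: "('v, 'e) pre_digraph \<Rightarrow> ('v, 'e) generator set" where
  "generators E = Vertex ` verts E \<union> Edge ` arcs E \<union> Ghost ` arcs E"

text \<open>
  Words form a monoid under concatenation; this wrapper makes the convolution product of
  \<open>Poly_Mapping\<close> the product of the free algebra.
\<close>

datatype 'g monomial = Monomial (letters: "'g list")

instantiation monomial :: (type) monoid_add
begin

definition zero_monomial :: "'a monomial" where
  "0 = Monomial []"

definition plus_monomial :: "'a monomial \<Rightarrow> 'a monomial \<Rightarrow> 'a monomial" where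
  "u + w = Monomial (letters u @ letters w)"

instance
  by standard (simp_all add: zero_monomial_def plus_monomial_def)

end

type_synonym ('v, 'e) free_alg = "('v, 'e) generator monomial \<Rightarrow>\<^sub>0 complex"

definition monomial_star :: "('v, 'e) generator monomial \<Rightarrow> ('v, 'e) generator monomial" where
  "monomial_star w = Monomial (rev (map generator_star (letters w)))"

definition free_star :: "('v, 'e) free_alg \<Rightarrow> ('v, 'e) free_alg" where
  "free_star x = Poly_Mapping.map cnj (Poly_Mapping.map_key monomial_star x)"

text \<open>
  Linear combinations of nonempty words: the free nonunital algebra on the vertices, the
  edges \<open>e\<close> and the ghost edges \<open>e\<^sup>*\<close>, that is, the free \<open>*\<close>-algebra on self-adjoint
  generators \<open>v\<close> and generators \<open>e\<close>.
\<close>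

definition free_star_algebra :: "('v, 'e) pre_digraph \<Rightarrow> ('v, 'e) free_alg star_algebra" where
  "free_star_algebra E =
     \<lparr>carrier = {x. \<forall>w\<in>Poly_Mapping.keys x. letters w \<noteq> [] \<and> set (letters w) \<subseteq> generators E},
      mult = (*),
      one = undefined,
      zero = 0,
      add = (+),
      smult = (\<lambda>c x. Poly_Mapping.single 0 c * x),
      adj = free_star\<rparr>"

definition gen :: "('v, 'e) generator \<Rightarrow> ('v, 'e) free_alg" where
  "gen g = Poly_Mapping.single (Monomial [g]) 1"

abbreviation vert_gen :: "'v \<Rightarrow> ('v, 'e) free_alg" where
  "vert_gen v \<equiv> gen (Vertex v)"

abbreviation edge_gen :: "'e \<Rightarrow> ('v, 'e) free_alg" where
  "edge_gen e \<equiv> gen (Edge e)"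

abbreviation ghost_gen :: "'e \<Rightarrow> ('v, 'e) free_alg" where
  "ghost_gen e \<equiv> gen (Ghost e)"


section \<open>Leavitt path algebras\<close>

text \<open>A relation \<open>x = y\<close> is recorded as the relator \<open>x - y\<close>.\<close>

definition leavitt_relators :: "('v, 'e) pre_digraph \<Rightarrow> ('v, 'e) free_alg set" where
  "leavitt_relators E =
     {vert_gen v * vert_gen v - vert_gen v | v. v \<in> verts E} \<union>
     {vert_gen v * vert_gen w | v w. v \<in> verts E \<and> w \<in> verts E \<and> v \<noteq> w} \<union>
     {vert_gen (tail E e) * edge_gen e - edge_gen e | e. e \<in> arcs E} \<union>
     {edge_gen e * vert_gen (head E e) - edge_gen e | e. e \<in> arcs E} \<union>
     {vert_gen (head E e) * ghost_gen e - ghost_gen e | e. e \<in> arcs E} \<union>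
     {ghost_gen e * vert_gen (tail E e) - ghost_gen e | e. e \<in> arcs E} \<union>
     {ghost_gen e * edge_gen e - vert_gen (head E e) | e. e \<in> arcs E} \<union>
     {ghost_gen e * edge_gen f | e f. e \<in> arcs E \<and> f \<in> arcs E \<and> e \<noteq> f} \<union>
     {vert_gen v - (\<Sum>e\<in>out_arcs E v. edge_gen e * ghost_gen e) | v. regular_vertex E v}"

inductive_set leavitt_ideal :: "('v, 'e) pre_digraph \<Rightarrow> ('v, 'e) free_alg set"
  for E :: "('v, 'e) pre_digraph" where
  zero: "0 \<in> leavitt_ideal E"
| relator: "x \<in> leavitt_relators E \<Longrightarrow> x \<in> leavitt_ideal E"
| add: "\<lbrakk>x \<in> leavitt_ideal E; y \<in> leavitt_ideal E\<rbrakk> \<Longrightarrow> x + y \<in> leavitt_ideal E"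
| smult: "x \<in> leavitt_ideal E \<Longrightarrow> c \<odot>\<^bsub>free_star_algebra E\<^esub> x \<in> leavitt_ideal E"
| mult_left: "\<lbrakk>x \<in> leavitt_ideal E; a \<in> carrier (free_star_algebra E)\<rbrakk> \<Longrightarrow> a * x \<in> leavitt_ideal E"
| mult_right: "\<lbrakk>x \<in> leavitt_ideal E; a \<in> carrier (free_star_algebra E)\<rbrakk> \<Longrightarrow> x * a \<in> leavitt_ideal E"

definition leavitt_rel :: "('v, 'e) pre_digraph \<Rightarrow> (('v, 'e) free_alg \<times> ('v, 'e) free_alg) set" where
  "leavitt_rel E = {(x, y). x \<in> carrier (free_star_algebra E) \<and> y \<in> carrier (free_star_algebra E)
     \<and> x - y \<in> leavitt_ideal E}"

definition leavitt_path_algebra :: "('v, 'e) pre_digraph \<Rightarrow> ('v, 'e) free_alg set star_algebra" where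
  "leavitt_path_algebra E = quot_star_algebra (free_star_algebra E) (leavitt_rel E)"


section \<open>Graph \<open>C\<^sup>*\<close>-algebras\<close>

text \<open>
  The order of projections is \<open>q \<le> p \<longleftrightarrow> p q = q = q p\<close>.
\<close>

definition is_projection :: "('a, 'm) star_algebra_scheme \<Rightarrow> 'a \<Rightarrow> bool" where
  "is_projection A p \<longleftrightarrow> p \<in> carrier A \<and> adj A p = p \<and> p \<otimes>\<^bsub>A\<^esub> p = p"

definition projection_le :: "('a, 'm) star_algebra_scheme \<Rightarrow> 'a \<Rightarrow> 'a \<Rightarrow> bool" where
  "projection_le A q p \<longleftrightarrow> p \<otimes>\<^bsub>A\<^esub> q = q \<and> q \<otimes>\<^bsub>A\<^esub> p = q"

definition is_partial_isometry :: "('a, 'm) star_algebra_scheme \<Rightarrow> 'a \<Rightarrow> bool" where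
  "is_partial_isometry A s \<longleftrightarrow> s \<in> carrier A \<and> s \<otimes>\<^bsub>A\<^esub> adj A s \<otimes>\<^bsub>A\<^esub> s = s"

definition ck_family ::
  "('v, 'e) pre_digraph \<Rightarrow> ('a, 'm) star_algebra_scheme \<Rightarrow> ('v \<Rightarrow> 'a) \<Rightarrow> ('e \<Rightarrow> 'a) \<Rightarrow> bool" where
  "ck_family E A p s \<longleftrightarrow>
     (\<forall>v\<in>verts E. is_projection A (p v)) \<and>
     (\<forall>v\<in>verts E. \<forall>w\<in>verts E. v \<noteq> w \<longrightarrow> p v \<otimes>\<^bsub>A\<^esub> p w = \<zero>\<^bsub>A\<^esub>) \<and>
     (\<forall>e\<in>arcs E. is_partial_isometry A (s e)) \<and>
     (\<forall>e\<in>arcs E. \<forall>f\<in>arcs E. e \<noteq> f \<longrightarrow> adj A (s e) \<otimes>\<^bsub>A\<^esub> s f = \<zero>\<^bsub>A\<^esub>) \<and>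
     (\<forall>e\<in>arcs E. adj A (s e) \<otimes>\<^bsub>A\<^esub> s e = p (head E e)) \<and>
     (\<forall>e\<in>arcs E. projection_le A (s e \<otimes>\<^bsub>A\<^esub> adj A (s e)) (p (tail E e))) \<and>
     (\<forall>v. regular_vertex E v \<longrightarrow> p v = (\<Oplus>\<^bsub>A\<^esub>e\<in>out_arcs E v. s e \<otimes>\<^bsub>A\<^esub> adj A (s e)))"

text \<open>The relations of a Cuntz--Krieger family, as relators in the free \<open>*\<close>-algebra.\<close>

definition ck_relators :: "('v, 'e) pre_digraph \<Rightarrow> ('v, 'e) free_alg set" where
  "ck_relators E =
     {vert_gen v * vert_gen v - vert_gen v | v. v \<in> verts E} \<union>
     {vert_gen v * vert_gen w | v w. v \<in> verts E \<and> w \<in> verts E \<and> v \<noteq> w} \<union>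
     {edge_gen e * ghost_gen e * edge_gen e - edge_gen e | e. e \<in> arcs E} \<union>
     {ghost_gen e * edge_gen f | e f. e \<in> arcs E \<and> f \<in> arcs E \<and> e \<noteq> f} \<union>
     {ghost_gen e * edge_gen e - vert_gen (head E e) | e. e \<in> arcs E} \<union>
     {vert_gen (tail E e) * (edge_gen e * ghost_gen e) - edge_gen e * ghost_gen e | e. e \<in> arcs E} \<union>
     {edge_gen e * ghost_gen e * vert_gen (tail E e) - edge_gen e * ghost_gen e | e. e \<in> arcs E} \<union>
     {vert_gen v - (\<Sum>e\<in>out_arcs E v. edge_gen e * ghost_gen e) | v. regular_vertex E v}"

definition ck_seminorms :: "('v, 'e) pre_digraph \<Rightarrow> (('v, 'e) free_alg \<Rightarrow> real) set" where
  "ck_seminorms E = {q. cstar_seminorm (free_star_algebra E) q \<and> (\<forall>x\<in>ck_relators E. q x = 0)}"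

text \<open>
  The universal \<open>C\<^sup>*\<close>-seminorm.  The \<open>C\<^sup>*\<close>-seminorms \<open>q\<close> in question are exactly the
  functions \<open>x \<mapsto> \<parallel>\<pi> x\<parallel>\<close>, where \<open>\<pi>\<close> is the \<open>*\<close>-homomorphism from the free
  \<open>*\<close>-algebra to a \<open>C\<^sup>*\<close>-algebra given by a Cuntz--Krieger family; phrasing the supremum
  this way avoids fixing a type for the elements of these \<open>C\<^sup>*\<close>-algebras.  The algebra
  defined below is the universal \<open>C\<^sup>*\<close>-algebra generated by a Cuntz--Krieger family: see
  \<open>graph_cstar_algebra\<close>, \<open>graph_cstar_ck_family\<close>, \<open>graph_cstar_generated\<close> and
  \<open>graph_cstar_universal\<close> at the end of this theory.
\<close>

definition ck_norm :: "('v, 'e) pre_digraph \<Rightarrow> ('v, 'e) free_alg \<Rightarrow> real" where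
  "ck_norm E x = (SUP q\<in>ck_seminorms E. q x)"

definition graph_cstar_algebra ::
  "('v, 'e) pre_digraph \<Rightarrow> (nat \<Rightarrow> ('v, 'e) free_alg) set normed_star_algebra" where
  "graph_cstar_algebra E = cstar_completion (free_star_algebra E) (ck_norm E)"

definition graph_proj :: "('v, 'e) pre_digraph \<Rightarrow> 'v \<Rightarrow> (nat \<Rightarrow> ('v, 'e) free_alg) set" where
  "graph_proj E v = completion_map (free_star_algebra E) (ck_norm E) (vert_gen v)"

definition graph_isom :: "('v, 'e) pre_digraph \<Rightarrow> 'e \<Rightarrow> (nat \<Rightarrow> ('v, 'e) free_alg) set" where
  "graph_isom E e = completion_map (free_star_algebra E) (ck_norm E) (edge_gen e)"


section \<open>Facts on \<open>*\<close>-algebras and completions\<close>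

context star_algebra
begin

lemma smult_zero_left: "x \<in> carrier A \<Longrightarrow> 0 \<odot> x = \<zero>"
  using smult_add_left[of x 0 0] smult_closed[of x 0] by (simp add: add.r_cancel_one)

lemma smult_zero_right: "c \<odot> \<zero> = \<zero>"
  using smult_add_right[of \<zero> \<zero> c] smult_closed[of \<zero> c] by (simp add: add.r_cancel_one)

lemma a_inv_eq_smult: "x \<in> carrier A \<Longrightarrow> \<ominus> x = (-1) \<odot> x"
proof -
  assume x: "x \<in> carrier A"
  have "x \<oplus> (-1) \<odot> x = (1 + (-1)) \<odot> x"
    using x smult_add_left[of x 1 "-1"] by (simp add: smult_one)
  also have "\<dots> = \<zero>"
    using smult_zero_left[OF x] by simp
  finally have "(-1) \<odot> x \<oplus> x = \<zero>"
    using x smult_closed a_comm by metis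
  then show ?thesis
    using x smult_closed by (simp add: minus_equality)
qed

lemma minus_eq_smult: "y \<in> carrier A \<Longrightarrow> x \<ominus> y = x \<oplus> (-1) \<odot> y"
  by (simp add: a_minus_def a_inv_eq_smult)

lemma mult_zero_left: "x \<in> carrier A \<Longrightarrow> \<zero> \<otimes> x = \<zero>"
  using smult_mult_left[of \<zero> x 0] by (simp add: smult_zero_left mult_closed)

lemma mult_zero_right: "x \<in> carrier A \<Longrightarrow> x \<otimes> \<zero> = \<zero>"
  using smult_mult_right[of x \<zero> 0] by (simp add: smult_zero_left mult_closed)

lemma adj_zero: "adj A \<zero> = \<zero>"
  using adj_smult[of \<zero> 0] by (simp add: smult_zero_left adj_closed)

lemmas closed = mult_closed smult_closed adj_closed

lemma mult_diff_left:
  "\<lbrakk>x \<in> carrier A; y \<in> carrier A; z \<in> carrier A\<rbrakk> \<Longrightarrow> (x \<ominus> y) \<otimes> z = x \<otimes> z \<ominus> y \<otimes> z"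
  by (simp add: minus_eq_smult closed distrib_right smult_mult_left)

lemma mult_diff_right:
  "\<lbrakk>x \<in> carrier A; y \<in> carrier A; z \<in> carrier A\<rbrakk> \<Longrightarrow> x \<otimes> (y \<ominus> z) = x \<otimes> y \<ominus> x \<otimes> z"
  by (simp add: minus_eq_smult closed distrib_left smult_mult_right)

lemma smult_diff:
  "\<lbrakk>x \<in> carrier A; y \<in> carrier A\<rbrakk> \<Longrightarrow> c \<odot> (x \<ominus> y) = c \<odot> x \<ominus> c \<odot> y"
  by (simp add: minus_eq_smult closed smult_add_right flip: smult_assoc)

lemma adj_diff:
  "\<lbrakk>x \<in> carrier A; y \<in> carrier A\<rbrakk> \<Longrightarrow> adj A (x \<ominus> y) = adj A x \<ominus> adj A y"
  by (simp add: minus_eq_smult closed adj_add adj_smult)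

lemma diff_add_diff:
  assumes "x \<in> carrier A" "y \<in> carrier A" "z \<in> carrier A"
  shows "(x \<ominus> y) \<oplus> (y \<ominus> z) = x \<ominus> z"
  using assms by (simp add: a_minus_def a_ac r_neg1 r_neg2)

lemma add_diff_add:
  assumes "x \<in> carrier A" "y \<in> carrier A" "x' \<in> carrier A" "y' \<in> carrier A"
  shows "(x \<oplus> y) \<ominus> (x' \<oplus> y') = (x \<ominus> x') \<oplus> (y \<ominus> y')"
  using assms by (simp add: a_minus_def a_ac minus_add)

lemma diff_self: "x \<in> carrier A \<Longrightarrow> x \<ominus> x = \<zero>"
  by (simp add: a_minus_def r_neg)

lemma diff_zero: "x \<in> carrier A \<Longrightarrow> x \<ominus> \<zero> = x"
  by (simp add: a_minus_def)

lemma diff_eq_zeroD: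
  assumes "x \<in> carrier A" "y \<in> carrier A" "x \<ominus> y = \<zero>"
  shows "x = y"
proof -
  have "x = (x \<ominus> y) \<oplus> y"
    using assms(1,2) by (simp add: a_minus_def a_assoc l_neg)
  then show ?thesis
    using assms by simp
qed

end

lemma star_algebraI:
  fixes A (structure)
  assumes "\<zero> \<in> carrier A"
    and "\<And>x y. \<lbrakk>x \<in> carrier A; y \<in> carrier A\<rbrakk> \<Longrightarrow> x \<oplus> y \<in> carrier A"
    and "\<And>x y z. \<lbrakk>x \<in> carrier A; y \<in> carrier A; z \<in> carrier A\<rbrakk> \<Longrightarrow> (x \<oplus> y) \<oplus> z = x \<oplus> (y \<oplus> z)"
    and "\<And>x y. \<lbrakk>x \<in> carrier A; y \<in> carrier A\<rbrakk> \<Longrightarrow> x \<oplus> y = y \<oplus> x"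
    and "\<And>x. x \<in> carrier A \<Longrightarrow> \<zero> \<oplus> x = x"
    and "\<And>x. x \<in> carrier A \<Longrightarrow> (-1) \<odot> x \<oplus> x = \<zero>"
    and "\<And>x c. x \<in> carrier A \<Longrightarrow> c \<odot> x \<in> carrier A"
    and axioms: "star_algebra_axioms A"
  shows "star_algebra A"
proof -
  have "abelian_group A"
  proof (rule abelian_groupI)
    fix x assume "x \<in> carrier A"
    then show "\<exists>y\<in>carrier A. y \<oplus> x = \<zero>"
      using assms(6,7) by blast
  qed (rule assms(1-5); assumption)+
  then show ?thesis
    using axioms by (simp add: star_algebra_def)
qed

subsection \<open>Quotients\<close>

locale star_congruence = star_algebra A for A (structure) +
  fixes r
  assumes eqv: "equiv (carrier A) r"
    and cong_add: "\<lbrakk>(x, x') \<in> r; (y, y') \<in> r\<rbrakk> \<Longrightarrow> (x \<oplus> y, x' \<oplus> y') \<in> r"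
    and cong_mult: "\<lbrakk>(x, x') \<in> r; (y, y') \<in> r\<rbrakk> \<Longrightarrow> (x \<otimes> y, x' \<otimes> y') \<in> r"
    and cong_smult: "(x, x') \<in> r \<Longrightarrow> (c \<odot> x, c \<odot> x') \<in> r"
    and cong_adj: "(x, x') \<in> r \<Longrightarrow> (adj A x, adj A x') \<in> r"
begin

abbreviation "Q \<equiv> quot_star_algebra A r"

lemma quot_carrier: "carrier Q = carrier A // r"
  by (simp add: quot_star_algebra_def)

lemma quot_class: "x \<in> carrier A \<Longrightarrow> r `` {x} \<in> carrier Q"
  by (simp add: quot_carrier quotientI)

lemma quot_cases:
  assumes "X \<in> carrier Q"
  obtains x where "x \<in> carrier A" "X = r `` {x}"
  using assms by (auto simp: quot_carrier elim: quotientE)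

lemma quot_zero: "\<zero>\<^bsub>Q\<^esub> = r `` {\<zero>}"
  by (simp add: quot_star_algebra_def)

lemma quot_add:
  "\<lbrakk>x \<in> carrier A; y \<in> carrier A\<rbrakk> \<Longrightarrow> r `` {x} \<oplus>\<^bsub>Q\<^esub> r `` {y} = r `` {x \<oplus> y}"
proof -
  assume x: "x \<in> carrier A" "y \<in> carrier A"
  have "congruent2 r r (\<lambda>x y. r `` {x \<oplus> y})"
    by (intro congruent2I' equiv_class_eq[OF eqv] cong_add)
  from UN_equiv_class2[OF eqv eqv this x] show ?thesis
    by (simp add: quot_star_algebra_def)
qed

lemma quot_mult:
  "\<lbrakk>x \<in> carrier A; y \<in> carrier A\<rbrakk> \<Longrightarrow> r `` {x} \<otimes>\<^bsub>Q\<^esub> r `` {y} = r `` {x \<otimes> y}"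
proof -
  assume x: "x \<in> carrier A" "y \<in> carrier A"
  have "congruent2 r r (\<lambda>x y. r `` {x \<otimes> y})"
    by (intro congruent2I' equiv_class_eq[OF eqv] cong_mult)
  from UN_equiv_class2[OF eqv eqv this x] show ?thesis
    by (simp add: quot_star_algebra_def)
qed

lemma quot_smult: "x \<in> carrier A \<Longrightarrow> c \<odot>\<^bsub>Q\<^esub> r `` {x} = r `` {c \<odot> x}"
proof -
  assume x: "x \<in> carrier A"
  have "congruent r (\<lambda>x. r `` {c \<odot> x})"
    by (intro congruentI equiv_class_eq[OF eqv] cong_smult)
  from UN_equiv_class[OF eqv this x] show ?thesis
    by (simp add: quot_star_algebra_def)
qed

lemma quot_adj: "x \<in> carrier A \<Longrightarrow> adj Q (r `` {x}) = r `` {adj A x}"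
proof -
  assume x: "x \<in> carrier A"
  have "congruent r (\<lambda>x. r `` {adj A x})"
    by (intro congruentI equiv_class_eq[OF eqv] cong_adj)
  from UN_equiv_class[OF eqv this x] show ?thesis
    by (simp add: quot_star_algebra_def)
qed

lemmas quot_ops = quot_zero quot_add quot_mult quot_smult quot_adj

lemma quot_star_hom: "star_hom A Q (\<lambda>x. r `` {x})"
  by (auto simp: star_hom_def quot_class quot_ops)

lemma quot_star_algebra: "star_algebra Q"
proof (rule star_algebraI)
  show "star_algebra_axioms Q"
    unfolding star_algebra_axioms_def
    by (auto elim!: quot_cases simp: quot_ops quot_class closed mult_assoc distrib_right distrib_left
        smult_add_right smult_add_left smult_assoc smult_one smult_mult_left smult_mult_right
        adj_adj adj_add adj_smult adj_mult)
next
  fix X assume "X \<in> carrier Q"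
  then obtain x where x: "x \<in> carrier A" "X = r `` {x}"
    by (rule quot_cases)
  then show "(-1) \<odot>\<^bsub>Q\<^esub> X \<oplus>\<^bsub>Q\<^esub> X = \<zero>\<^bsub>Q\<^esub>"
    by (simp add: quot_ops closed l_neg flip: a_inv_eq_smult)
next
  fix X Y Z assume "X \<in> carrier Q" "Y \<in> carrier Q" "Z \<in> carrier Q"
  then obtain x y z where "x \<in> carrier A" "X = r `` {x}" "y \<in> carrier A" "Y = r `` {y}"
    "z \<in> carrier A" "Z = r `` {z}"
    by (meson quot_cases)
  then show "X \<oplus>\<^bsub>Q\<^esub> Y \<oplus>\<^bsub>Q\<^esub> Z = X \<oplus>\<^bsub>Q\<^esub> (Y \<oplus>\<^bsub>Q\<^esub> Z)"
    by (simp add: quot_add a_assoc)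
next
  fix X Y assume "X \<in> carrier Q" "Y \<in> carrier Q"
  then obtain x y where "x \<in> carrier A" "X = r `` {x}" "y \<in> carrier A" "Y = r `` {y}"
    by (meson quot_cases)
  then show "X \<oplus>\<^bsub>Q\<^esub> Y = Y \<oplus>\<^bsub>Q\<^esub> X"
    by (simp add: quot_add a_comm)
qed (auto elim!: quot_cases simp: quot_ops quot_class closed)

end


locale seminormed_star_algebra = star_algebra A for A (structure) +
  fixes N :: "'a \<Rightarrow> real"
  assumes seminorm: "cstar_seminorm A N"
begin

lemma N_nonneg: "x \<in> carrier A \<Longrightarrow> 0 \<le> N x"
  using seminorm by (simp add: cstar_seminorm_def)

lemma N_add: "\<lbrakk>x \<in> carrier A; y \<in> carrier A\<rbrakk> \<Longrightarrow> N (x \<oplus> y) \<le> N x + N y"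
  using seminorm by (simp add: cstar_seminorm_def)

lemma N_smult: "x \<in> carrier A \<Longrightarrow> N (c \<odot> x) = cmod c * N x"
  using seminorm by (simp add: cstar_seminorm_def)

lemma N_mult: "\<lbrakk>x \<in> carrier A; y \<in> carrier A\<rbrakk> \<Longrightarrow> N (x \<otimes> y) \<le> N x * N y"
  using seminorm by (simp add: cstar_seminorm_def)

lemma N_cstar: "x \<in> carrier A \<Longrightarrow> N (adj A x \<otimes> x) = (N x)\<^sup>2"
  using seminorm by (simp add: cstar_seminorm_def)

lemma N_zero: "N \<zero> = 0"
  using N_smult[of \<zero> 0] by (simp add: smult_zero_right)

lemma N_adj_le: "x \<in> carrier A \<Longrightarrow> N x \<le> N (adj A x)"
proof -
  assume x: "x \<in> carrier A"
  have "N x * N x \<le> N (adj A x) * N x"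
    using N_mult[of "adj A x" x] N_cstar[OF x] x by (simp add: adj_closed power2_eq_square)
  then show ?thesis
    using N_nonneg[of x] N_nonneg[of "adj A x"] x adj_closed
    by (metis linorder_not_le mult_less_cancel_right_disj order_le_less)
qed

lemma N_adj: "x \<in> carrier A \<Longrightarrow> N (adj A x) = N x"
  by (metis N_adj_le adj_adj adj_closed order_antisym)

lemma N_uminus: "x \<in> carrier A \<Longrightarrow> N (\<ominus> x) = N x"
  by (simp add: a_inv_eq_smult N_smult)

lemma N_diff: "\<lbrakk>x \<in> carrier A; y \<in> carrier A\<rbrakk> \<Longrightarrow> N (x \<ominus> y) \<le> N x + N y"
  using N_add[of x "\<ominus> y"] by (simp add: a_minus_def N_uminus)

lemma N_triangle:
  "\<lbrakk>x \<in> carrier A; y \<in> carrier A; z \<in> carrier A\<rbrakk> \<Longrightarrow> N (x \<ominus> z) \<le> N (x \<ominus> y) + N (y \<ominus> z)"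
  using N_add[of "x \<ominus> y" "y \<ominus> z"] by (simp add: diff_add_diff)

lemma N_commute: "\<lbrakk>x \<in> carrier A; y \<in> carrier A\<rbrakk> \<Longrightarrow> N (x \<ominus> y) = N (y \<ominus> x)"
proof -
  assume xy: "x \<in> carrier A" "y \<in> carrier A"
  then have "y \<ominus> x = \<ominus> (x \<ominus> y)"
    by (simp add: a_minus_def minus_add a_comm)
  then show ?thesis
    using xy by (simp add: N_uminus)
qed

lemma N_abs_diff: "\<lbrakk>x \<in> carrier A; y \<in> carrier A\<rbrakk> \<Longrightarrow> \<bar>N x - N y\<bar> \<le> N (x \<ominus> y)"
  using N_triangle[of x y \<zero>] N_triangle[of y x \<zero>] N_commute[of x y] by (simp add: diff_zero)

lemma N_add_diff:
  "\<lbrakk>x \<in> carrier A; y \<in> carrier A; x' \<in> carrier A; y' \<in> carrier A\<rbrakk>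
    \<Longrightarrow> N ((x \<oplus> y) \<ominus> (x' \<oplus> y')) \<le> N (x \<ominus> x') + N (y \<ominus> y')"
  using N_add[of "x \<ominus> x'" "y \<ominus> y'"] by (simp add: add_diff_add)

lemma N_mult_diff:
  assumes "x \<in> carrier A" "y \<in> carrier A" "x' \<in> carrier A" "y' \<in> carrier A"
  shows "N (x \<otimes> y \<ominus> x' \<otimes> y') \<le> N x * N (y \<ominus> y') + N (x \<ominus> x') * N y'"
proof -
  have "N (x \<otimes> y \<ominus> x' \<otimes> y') \<le> N (x \<otimes> y \<ominus> x \<otimes> y') + N (x \<otimes> y' \<ominus> x' \<otimes> y')"
    using assms by (intro N_triangle closed) auto
  also have "N (x \<otimes> y \<ominus> x \<otimes> y') \<le> N x * N (y \<ominus> y')"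
    using assms N_mult[of x "y \<ominus> y'"] by (simp add: mult_diff_right)
  also have "N (x \<otimes> y' \<ominus> x' \<otimes> y') \<le> N (x \<ominus> x') * N y'"
    using assms N_mult[of "x \<ominus> x'" y'] by (simp add: mult_diff_left)
  finally show ?thesis by simp
qed

lemma N_smult_diff:
  "\<lbrakk>x \<in> carrier A; y \<in> carrier A\<rbrakk> \<Longrightarrow> N (c \<odot> x \<ominus> c \<odot> y) = cmod c * N (x \<ominus> y)"
  by (simp add: N_smult flip: smult_diff)

lemma N_adj_diff:
  "\<lbrakk>x \<in> carrier A; y \<in> carrier A\<rbrakk> \<Longrightarrow> N (adj A x \<ominus> adj A y) = N (x \<ominus> y)"
  by (simp add: N_adj flip: adj_diff)


subsection \<open>Cauchy sequences\<close>

abbreviation "cauchy \<equiv> cauchy_in A N"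

lemma cauchy_closed: "cauchy X \<Longrightarrow> X n \<in> carrier A"
  by (simp add: cauchy_in_def)

lemma cauchy_real: "cauchy X \<Longrightarrow> convergent (\<lambda>n. N (X n))"
  unfolding real_Cauchy_convergent Cauchy_convergent_iff[symmetric] Cauchy_def cauchy_in_def dist_real_def
  by (meson N_abs_diff order_le_less_trans)

lemma cauchy_bound: "cauchy X \<Longrightarrow> \<exists>K>0. \<forall>n. N (X n) \<le> K"
proof -
  assume X: "cauchy X"
  obtain K where "K > 0" "\<And>n. norm (N (X n)) \<le> K"
    using convergent_imp_Bseq[OF cauchy_real[OF X]] by (auto simp: Bseq_def)
  then show ?thesis
    by (metis abs_le_D1 real_norm_def)
qed

lemma cauchy_const: "x \<in> carrier A \<Longrightarrow> cauchy (\<lambda>n. x)"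
  by (simp add: cauchy_in_def diff_self N_zero)

lemma cauchy_transfer:
  assumes "\<And>n. Z n \<in> carrier A" "K > 0" "cauchy X" "cauchy Y"
    and le: "\<And>m n. N (Z m \<ominus> Z n) \<le> K * (N (X m \<ominus> X n) + N (Y m \<ominus> Y n))"
  shows "cauchy Z"
  unfolding cauchy_in_def
proof (intro conjI allI impI)
  fix \<epsilon> :: real assume "\<epsilon> > 0"
  then have \<epsilon>: "\<epsilon> / (2 * K) > 0" using \<open>K > 0\<close> by simp
  obtain M1 where M1: "\<And>m n. \<lbrakk>m \<ge> M1; n \<ge> M1\<rbrakk> \<Longrightarrow> N (X m \<ominus> X n) < \<epsilon> / (2 * K)"
    using \<open>cauchy X\<close> \<epsilon> unfolding cauchy_in_def by meson
  obtain M2 where M2: "\<And>m n. \<lbrakk>m \<ge> M2; n \<ge> M2\<rbrakk> \<Longrightarrow> N (Y m \<ominus> Y n) < \<epsilon> / (2 * K)"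
    using \<open>cauchy Y\<close> \<epsilon> unfolding cauchy_in_def by meson
  have "N (Z m \<ominus> Z n) < \<epsilon>" if "m \<ge> max M1 M2" "n \<ge> max M1 M2" for m n
  proof -
    have "N (X m \<ominus> X n) + N (Y m \<ominus> Y n) < \<epsilon> / K"
      using M1[of m n] M2[of m n] that by (simp add: field_simps)
    then have "K * (N (X m \<ominus> X n) + N (Y m \<ominus> Y n)) < \<epsilon>"
      using \<open>K > 0\<close> by (simp add: field_simps)
    then show ?thesis using le[of m n] by linarith
  qed
  then show "\<exists>M. \<forall>m\<ge>M. \<forall>n\<ge>M. N (Z m \<ominus> Z n) < \<epsilon>" by blast
qed (use assms in simp)

lemma cauchy_add: "\<lbrakk>cauchy X; cauchy Y\<rbrakk> \<Longrightarrow> cauchy (\<lambda>n. X n \<oplus> Y n)"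
  by (rule cauchy_transfer[where K = 1 and X = X and Y = Y]) (auto simp: cauchy_closed intro: N_add_diff)

lemma cauchy_smult: "cauchy X \<Longrightarrow> cauchy (\<lambda>n. c \<odot> X n)"
  by (rule cauchy_transfer[where K = "cmod c + 1" and X = X and Y = X])
    (auto simp: cauchy_closed closed N_smult_diff N_nonneg intro!: mult_mono add_pos_nonneg add_nonneg_pos)

lemma cauchy_adj: "cauchy X \<Longrightarrow> cauchy (\<lambda>n. adj A (X n))"
  by (rule cauchy_transfer[where K = 1 and X = X and Y = X])
    (auto simp: cauchy_closed closed N_adj_diff N_nonneg)

lemma cauchy_mult:
  assumes "cauchy X" "cauchy Y"
  shows "cauchy (\<lambda>n. X n \<otimes> Y n)"
proof -
  obtain K L where K: "K > 0" "\<And>n. N (X n) \<le> K" and L: "L > 0" "\<And>n. N (Y n) \<le> L"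
    using cauchy_bound[OF assms(1)] cauchy_bound[OF assms(2)] by auto
  show ?thesis
  proof (rule cauchy_transfer[where K = "K + L" and X = X and Y = Y])
    fix m n
    have nn: "0 \<le> N (X m \<ominus> X n)" "0 \<le> N (Y m \<ominus> Y n)"
      using assms by (auto intro!: N_nonneg simp: cauchy_closed)
    have "N (X m \<otimes> Y m \<ominus> X n \<otimes> Y n) \<le> N (X m) * N (Y m \<ominus> Y n) + N (X m \<ominus> X n) * N (Y n)"
      using assms by (intro N_mult_diff cauchy_closed)
    also have "\<dots> \<le> K * N (Y m \<ominus> Y n) + N (X m \<ominus> X n) * L"
      using K L nn by (intro add_mono mult_mono N_nonneg) (auto simp: assms cauchy_closed)
    also have "\<dots> \<le> (K + L) * (N (X m \<ominus> X n) + N (Y m \<ominus> Y n))"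
      using K L nn by (simp add: algebra_simps)
    finally show "N (X m \<otimes> Y m \<ominus> X n \<otimes> Y n) \<le> (K + L) * (N (X m \<ominus> X n) + N (Y m \<ominus> Y n))" .
  qed (use assms K L in \<open>auto simp: cauchy_closed closed\<close>)
qed

abbreviation "C \<equiv> cauchy_algebra A N"

lemma C_simps [simp]:
  "carrier C = {X. cauchy X}"
  "X \<otimes>\<^bsub>C\<^esub> Y = (\<lambda>n. X n \<otimes> Y n)"
  "X \<oplus>\<^bsub>C\<^esub> Y = (\<lambda>n. X n \<oplus> Y n)"
  "\<zero>\<^bsub>C\<^esub> = (\<lambda>n. \<zero>)"
  "c \<odot>\<^bsub>C\<^esub> X = (\<lambda>n. c \<odot> X n)"
  "adj C X = (\<lambda>n. adj A (X n))"
  by (simp_all add: cauchy_algebra_def)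

lemma C_star_algebra: "star_algebra C"
  by (rule star_algebraI)
    (auto simp: cauchy_const cauchy_add cauchy_smult cauchy_mult cauchy_adj cauchy_closed
      a_ac r_neg mult_assoc distrib_right distrib_left smult_add_right smult_add_left
      smult_assoc smult_one smult_mult_left smult_mult_right adj_adj adj_add adj_smult adj_mult
      star_algebra_axioms_def simp flip: a_inv_eq_smult)

abbreviation "R \<equiv> null_rel A N"

lemma null_relI:
  "\<lbrakk>cauchy X; cauchy Y; (\<lambda>n. N (X n \<ominus> Y n)) \<longlonglongrightarrow> 0\<rbrakk> \<Longrightarrow> (X, Y) \<in> R"
  by (simp add: null_rel_def)

lemma N_null_compare:
  assumes "\<And>n. Z n \<in> carrier A" "\<And>n. N (Z n) \<le> f n" "f \<longlonglongrightarrow> 0"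
  shows "(\<lambda>n. N (Z n)) \<longlonglongrightarrow> 0"
  by (rule tendsto_sandwich[of "\<lambda>_. 0" _ _ f]) (use assms N_nonneg in auto)

lemma R_congruence: "star_congruence C R"
proof -
  interpret C: star_algebra C by (rule C_star_algebra)
  show ?thesis
  proof
    show "equiv (carrier C) R"
    proof (rule equivI)
      show "R \<subseteq> carrier C \<times> carrier C"
        by (auto simp: null_rel_def)
      show "refl_on (carrier C) R"
        by (auto simp: refl_on_def null_rel_def diff_self N_zero cauchy_closed)
      show "sym R"
        by (auto simp: sym_def null_rel_def N_commute cauchy_closed)
      show "trans R"
      proof (rule transI)
        fix X Y Z assume XY: "(X, Y) \<in> R" and YZ: "(Y, Z) \<in> R"
        then have *: "cauchy X" "cauchy Y" "cauchy Z"
          by (auto simp: null_rel_def)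
        have "(\<lambda>n. N (X n \<ominus> Y n) + N (Y n \<ominus> Z n)) \<longlonglongrightarrow> 0"
          using XY YZ tendsto_add by (fastforce simp: null_rel_def)
        then have "(\<lambda>n. N (X n \<ominus> Z n)) \<longlonglongrightarrow> 0"
          by (rule N_null_compare[rotated 2]) (use * in \<open>auto simp: cauchy_closed intro: N_triangle\<close>)
        then show "(X, Z) \<in> R"
          using * by (intro null_relI)
      qed
    qed
  next
    fix X X' Y Y' assume XX: "(X, X') \<in> R" and YY: "(Y, Y') \<in> R"
    then have *: "cauchy X" "cauchy X'" "cauchy Y" "cauchy Y'"
      by (auto simp: null_rel_def)
    have lim: "(\<lambda>n. N (X n \<ominus> X' n)) \<longlonglongrightarrow> 0" "(\<lambda>n. N (Y n \<ominus> Y' n)) \<longlonglongrightarrow> 0"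
      using XX YY by (auto simp: null_rel_def)
    have "(\<lambda>n. N (X n \<ominus> X' n) + N (Y n \<ominus> Y' n)) \<longlonglongrightarrow> 0"
      using tendsto_add[OF lim] by simp
    then have "(\<lambda>n. N ((X n \<oplus> Y n) \<ominus> (X' n \<oplus> Y' n))) \<longlonglongrightarrow> 0"
      by (rule N_null_compare[rotated 2]) (use * in \<open>auto simp: cauchy_closed intro: N_add_diff\<close>)
    then show "(X \<oplus>\<^bsub>C\<^esub> Y, X' \<oplus>\<^bsub>C\<^esub> Y') \<in> R"
      using * by (auto intro!: null_relI cauchy_add)
    obtain K L where K: "K > 0" "\<And>n. N (X n) \<le> K" and L: "L > 0" "\<And>n. N (Y' n) \<le> L"
      using cauchy_bound[OF *(1)] cauchy_bound[OF *(4)] by auto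
    have "(\<lambda>n. K * N (Y n \<ominus> Y' n) + N (X n \<ominus> X' n) * L) \<longlonglongrightarrow> K * 0 + 0 * L"
      by (intro tendsto_intros lim)
    then have lim0: "(\<lambda>n. K * N (Y n \<ominus> Y' n) + N (X n \<ominus> X' n) * L) \<longlonglongrightarrow> 0"
      by simp
    have "N (X n \<otimes> Y n \<ominus> X' n \<otimes> Y' n) \<le> K * N (Y n \<ominus> Y' n) + N (X n \<ominus> X' n) * L" for n
    proof -
      have "N (X n \<otimes> Y n \<ominus> X' n \<otimes> Y' n) \<le> N (X n) * N (Y n \<ominus> Y' n) + N (X n \<ominus> X' n) * N (Y' n)"
        using * by (intro N_mult_diff cauchy_closed)
      also have "\<dots> \<le> K * N (Y n \<ominus> Y' n) + N (X n \<ominus> X' n) * L"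
        using K L by (intro add_mono mult_mono N_nonneg) (auto simp: * cauchy_closed)
      finally show ?thesis .
    qed
    from N_null_compare[OF _ this lim0]
    have "(\<lambda>n. N (X n \<otimes> Y n \<ominus> X' n \<otimes> Y' n)) \<longlonglongrightarrow> 0"
      using * by (simp add: cauchy_closed closed)
    then show "(X \<otimes>\<^bsub>C\<^esub> Y, X' \<otimes>\<^bsub>C\<^esub> Y') \<in> R"
      using * by (auto intro!: null_relI cauchy_mult)
  next
    fix X X' c assume XX: "(X, X') \<in> R"
    then have *: "cauchy X" "cauchy X'" "(\<lambda>n. N (X n \<ominus> X' n)) \<longlonglongrightarrow> 0"
      by (auto simp: null_rel_def)
    have "(\<lambda>n. N (c \<odot> X n \<ominus> c \<odot> X' n)) \<longlonglongrightarrow> 0"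
      using tendsto_mult_left[OF *(3), of "cmod c"] * by (simp add: N_smult_diff cauchy_closed)
    then show "(c \<odot>\<^bsub>C\<^esub> X, c \<odot>\<^bsub>C\<^esub> X') \<in> R"
      using * by (auto intro!: null_relI cauchy_smult)
    show "(adj C X, adj C X') \<in> R"
      using * by (auto intro!: null_relI cauchy_adj simp: N_adj_diff cauchy_closed)
  qed
qed

end


lemma star_algebra_cong:
  assumes "star_algebra A"
    and "carrier B = carrier A" "mult B = mult A" "zero B = zero A" "add B = add A"
      "smult B = smult A" "adj B = adj A"
  shows "star_algebra B"
proof -
  interpret star_algebra A by fact
  have "star_algebra_axioms A"
    using assms(1) by (simp add: star_algebra_def)
  then have ax: "star_algebra_axioms B"
    by (simp add: star_algebra_axioms_def assms(2-7))
  show ?thesis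
    by (rule star_algebraI[OF _ _ _ _ _ _ _ ax])
      (auto simp: assms(2-7) a_assoc l_neg closed intro: a_comm simp flip: a_inv_eq_smult)
qed

context seminormed_star_algebra
begin

interpretation QC: star_congruence C R
  by (rule R_congruence)

abbreviation "H \<equiv> cstar_completion A N"

abbreviation cls :: "(nat \<Rightarrow> 'a) \<Rightarrow> (nat \<Rightarrow> 'a) set" where
  "cls X \<equiv> R `` {X}"

lemma H_ops:
  "carrier H = carrier QC.Q" "mult H = mult QC.Q" "zero H = zero QC.Q" "add H = add QC.Q"
  "smult H = smult QC.Q" "adj H = adj QC.Q"
  by (simp_all add: cstar_completion_def star_algebra.defs quot_star_algebra_def)

lemma H_norm_def: "alg_norm H \<X> = (THE l. \<forall>X\<in>\<X>. (\<lambda>n. N (X n)) \<longlonglongrightarrow> l)"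
  by (simp add: cstar_completion_def star_algebra.defs quot_star_algebra_def)

lemma H_star_algebra: "star_algebra H"
  by (rule star_algebra_cong[OF QC.quot_star_algebra]) (simp_all add: H_ops)

interpretation H: star_algebra H
  by (rule H_star_algebra)

lemma cls_closed: "cauchy X \<Longrightarrow> cls X \<in> carrier H"
  using QC.quot_class by (simp add: H_ops)

lemma H_cases:
  assumes "\<X> \<in> carrier H"
  obtains X where "cauchy X" "\<X> = cls X"
  using assms by (auto simp: H_ops elim: QC.quot_cases)

lemma cls_eqI: "\<lbrakk>cauchy X; cauchy Y; (\<lambda>n. N (X n \<ominus> Y n)) \<longlonglongrightarrow> 0\<rbrakk> \<Longrightarrow> cls X = cls Y"
  by (rule equiv_class_eq[OF QC.eqv null_relI])

lemma cls_zero: "\<zero>\<^bsub>H\<^esub> = cls (\<lambda>n. \<zero>)"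
  using QC.quot_zero by (simp add: H_ops)

lemma cls_add: "\<lbrakk>cauchy X; cauchy Y\<rbrakk> \<Longrightarrow> cls X \<oplus>\<^bsub>H\<^esub> cls Y = cls (\<lambda>n. X n \<oplus> Y n)"
  using QC.quot_add[of X Y] by (simp add: H_ops)

lemma cls_mult: "\<lbrakk>cauchy X; cauchy Y\<rbrakk> \<Longrightarrow> cls X \<otimes>\<^bsub>H\<^esub> cls Y = cls (\<lambda>n. X n \<otimes> Y n)"
  using QC.quot_mult[of X Y] by (simp add: H_ops)

lemma cls_smult: "cauchy X \<Longrightarrow> c \<odot>\<^bsub>H\<^esub> cls X = cls (\<lambda>n. c \<odot> X n)"
  using QC.quot_smult[of X c] by (simp add: H_ops)

lemma cls_adj: "cauchy X \<Longrightarrow> adj H (cls X) = cls (\<lambda>n. adj A (X n))"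
  using QC.quot_adj[of X] by (simp add: H_ops)

lemma cls_minus: "\<lbrakk>cauchy X; cauchy Y\<rbrakk> \<Longrightarrow> cls X \<ominus>\<^bsub>H\<^esub> cls Y = cls (\<lambda>n. X n \<ominus> Y n)"
  by (simp add: H.minus_eq_smult cls_closed cls_smult cls_add cauchy_smult minus_eq_smult cauchy_closed)

lemma cauchy_minus: "\<lbrakk>cauchy X; cauchy Y\<rbrakk> \<Longrightarrow> cauchy (\<lambda>n. X n \<ominus> Y n)"
  by (simp add: minus_eq_smult cauchy_closed cauchy_add cauchy_smult)

lemma norm_tendsto: "cauchy X \<Longrightarrow> (\<lambda>n. N (X n)) \<longlonglongrightarrow> alg_norm H (cls X)"
proof -
  assume X: "cauchy X"
  then obtain l where l: "(\<lambda>n. N (X n)) \<longlonglongrightarrow> l"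
    using cauchy_real by (auto simp: convergent_def)
  have all: "(\<lambda>n. N (Y n)) \<longlonglongrightarrow> l" if "Y \<in> cls X" for Y
  proof -
    have Y: "cauchy Y" "(\<lambda>n. N (X n \<ominus> Y n)) \<longlonglongrightarrow> 0"
      using that by (auto simp: null_rel_def)
    have "(\<lambda>n. N (Y n) - N (X n)) \<longlonglongrightarrow> 0"
    proof (rule tendsto_0_le[OF Y(2), where K = 1])
      show "\<forall>\<^sub>F n in sequentially. norm (N (Y n) - N (X n)) \<le> norm (N (X n \<ominus> Y n)) * 1"
        using N_abs_diff N_nonneg X Y by (simp add: cauchy_closed abs_minus_commute)
    qed
    from tendsto_add[OF this l] show ?thesis by simp
  qed
  have "X \<in> cls X"
    using X by (simp add: null_rel_def diff_self cauchy_closed N_zero)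
  then have "alg_norm H (cls X) = l"
    unfolding H_norm_def using all LIMSEQ_unique by (intro the_equality) blast+
  then show ?thesis using l by simp
qed

lemma norm_eqI: "\<lbrakk>cauchy X; (\<lambda>n. N (X n)) \<longlonglongrightarrow> l\<rbrakk> \<Longrightarrow> alg_norm H (cls X) = l"
  using norm_tendsto LIMSEQ_unique by blast

lemma H_seminorm: "cstar_seminorm H (alg_norm H)"
  unfolding cstar_seminorm_def
proof (intro conjI ballI allI)
  fix \<X> assume "\<X> \<in> carrier H"
  then obtain X where X: "cauchy X" "\<X> = cls X" by (rule H_cases)
  note lX = norm_tendsto[OF X(1)]
  show "0 \<le> alg_norm H \<X>"
    unfolding X by (rule LIMSEQ_le_const[OF lX]) (auto intro: N_nonneg cauchy_closed X)
  show "alg_norm H (adj H \<X> \<otimes>\<^bsub>H\<^esub> \<X>) = (alg_norm H \<X>)\<^sup>2"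
    unfolding X cls_adj[OF X(1)] cls_mult[OF cauchy_adj[OF X(1)] X(1)]
    by (rule norm_eqI)
      (auto simp: X cauchy_mult cauchy_adj N_cstar cauchy_closed intro!: tendsto_power lX)
next
  fix \<X> c assume "\<X> \<in> carrier H"
  then obtain X where X: "cauchy X" "\<X> = cls X" by (rule H_cases)
  show "alg_norm H (c \<odot>\<^bsub>H\<^esub> \<X>) = cmod c * alg_norm H \<X>"
    unfolding X cls_smult[OF X(1)]
    by (rule norm_eqI)
      (auto simp: X cauchy_smult N_smult cauchy_closed intro!: tendsto_mult norm_tendsto)
next
  fix \<X> \<Y> assume "\<X> \<in> carrier H" "\<Y> \<in> carrier H"
  then obtain X Y where X: "cauchy X" "\<X> = cls X" and Y: "cauchy Y" "\<Y> = cls Y"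
    by (metis H_cases)
  note l = norm_tendsto[OF X(1)] norm_tendsto[OF Y(1)]
  show "alg_norm H (\<X> \<oplus>\<^bsub>H\<^esub> \<Y>) \<le> alg_norm H \<X> + alg_norm H \<Y>"
    unfolding X Y cls_add[OF X(1) Y(1)]
    by (rule LIMSEQ_le[OF norm_tendsto[OF cauchy_add[OF X(1) Y(1)]] tendsto_add[OF l]])
      (auto intro!: exI[of _ 0] N_add simp: cauchy_closed X Y)
  show "alg_norm H (\<X> \<otimes>\<^bsub>H\<^esub> \<Y>) \<le> alg_norm H \<X> * alg_norm H \<Y>"
    unfolding X Y cls_mult[OF X(1) Y(1)]
    by (rule LIMSEQ_le[OF norm_tendsto[OF cauchy_mult[OF X(1) Y(1)]] tendsto_mult[OF l]])
      (auto intro!: exI[of _ 0] N_mult simp: cauchy_closed X Y)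
qed

interpretation HN: seminormed_star_algebra H "alg_norm H"
  by unfold_locales (rule H_seminorm)

abbreviation \<iota> :: "'a \<Rightarrow> (nat \<Rightarrow> 'a) set" where
  "\<iota> \<equiv> completion_map A N"

lemma \<iota>_cls: "\<iota> x = cls (\<lambda>n. x)"
  by (simp add: completion_map_def)

lemma \<iota>_hom: "star_hom A H \<iota>"
  by (simp add: star_hom_def \<iota>_cls cls_closed cauchy_const cls_add cls_smult cls_mult cls_adj)

lemma \<iota>_closed: "x \<in> carrier A \<Longrightarrow> \<iota> x \<in> carrier H"
  by (simp add: \<iota>_cls cls_closed cauchy_const)

lemma \<iota>_norm: "x \<in> carrier A \<Longrightarrow> alg_norm H (\<iota> x) = N x"
  by (simp add: \<iota>_cls cauchy_const norm_eqI)

lemma \<iota>_minus: "\<lbrakk>x \<in> carrier A; y \<in> carrier A\<rbrakk> \<Longrightarrow> \<iota> x \<ominus>\<^bsub>H\<^esub> \<iota> y = \<iota> (x \<ominus> y)"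
  by (simp add: \<iota>_cls cls_minus cauchy_const)

lemma \<iota>_approx:
  assumes "cauchy X" "\<epsilon> > 0"
  shows "\<exists>M. \<forall>m\<ge>M. alg_norm H (cls X \<ominus>\<^bsub>H\<^esub> \<iota> (X m)) \<le> \<epsilon>"
proof -
  obtain M where M: "\<And>m n. \<lbrakk>m \<ge> M; n \<ge> M\<rbrakk> \<Longrightarrow> N (X m \<ominus> X n) < \<epsilon>"
    using assms unfolding cauchy_in_def by meson
  have "alg_norm H (cls X \<ominus>\<^bsub>H\<^esub> \<iota> (X m)) \<le> \<epsilon>" if "m \<ge> M" for m
  proof -
    have c: "cauchy (\<lambda>n. X n \<ominus> X m)"
      using assms(1) by (simp add: cauchy_minus cauchy_const cauchy_closed)
    have "alg_norm H (cls (\<lambda>n. X n \<ominus> X m)) \<le> \<epsilon>"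
      by (rule LIMSEQ_le_const2[OF norm_tendsto[OF c]])
        (use M that in \<open>auto intro!: exI[of _ M] less_imp_le\<close>)
    then show ?thesis
      using assms(1) by (simp add: \<iota>_cls cls_minus cauchy_const cauchy_closed)
  qed
  then show ?thesis by blast
qed

lemma \<iota>_converges: "cauchy X \<Longrightarrow> converges_in H (alg_norm H) (\<lambda>n. \<iota> (X n)) (cls X)"
  unfolding converges_in_def
proof (rule LIMSEQ_I)
  fix \<epsilon> :: real assume X: "cauchy X" and "0 < \<epsilon>"
  then have "\<epsilon> / 2 > 0" by simp
  from \<iota>_approx[OF X this] obtain M where
    "\<And>m. m \<ge> M \<Longrightarrow> alg_norm H (cls X \<ominus>\<^bsub>H\<^esub> \<iota> (X m)) \<le> \<epsilon> / 2" by blast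
  then have "alg_norm H (\<iota> (X m) \<ominus>\<^bsub>H\<^esub> cls X) < \<epsilon>" if "m \<ge> M" for m
    using that HN.N_commute[of "cls X" "\<iota> (X m)"] X \<open>0 < \<epsilon>\<close>
    by (fastforce simp: cls_closed \<iota>_closed cauchy_closed)
  moreover have "0 \<le> alg_norm H (\<iota> (X m) \<ominus>\<^bsub>H\<^esub> cls X)" for m
    by (intro HN.N_nonneg H.minus_closed cls_closed \<iota>_closed cauchy_closed X)
  ultimately show "\<exists>M. \<forall>m\<ge>M. norm (alg_norm H (\<iota> (X m) \<ominus>\<^bsub>H\<^esub> cls X) - 0) < \<epsilon>"
    by auto
qed

lemma H_dense: "\<lbrakk>\<X> \<in> carrier H; \<epsilon> > 0\<rbrakk> \<Longrightarrow> \<exists>x\<in>carrier A. alg_norm H (\<X> \<ominus>\<^bsub>H\<^esub> \<iota> x) \<le> \<epsilon>"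
  by (metis H_cases \<iota>_approx cauchy_closed order_refl)

lemma H_complete:
  assumes "cauchy_in H (alg_norm H) \<X>"
  shows "\<exists>l\<in>carrier H. converges_in H (alg_norm H) \<X> l"
proof -
  have \<X>: "\<X> k \<in> carrier H" for k
    using assms by (simp add: cauchy_in_def)
  have "\<exists>y\<in>carrier A. alg_norm H (\<X> k \<ominus>\<^bsub>H\<^esub> \<iota> y) \<le> inverse (real (Suc k))" for k
    by (rule H_dense) (auto simp: \<X>)
  then obtain y where y: "\<And>k. y k \<in> carrier A"
    and le: "\<And>k. alg_norm H (\<X> k \<ominus>\<^bsub>H\<^esub> \<iota> (y k)) \<le> inverse (real (Suc k))"
    by metis
  have "cauchy y"
    unfolding cauchy_in_def
  proof (intro conjI allI impI y)
    fix \<epsilon> :: real assume "\<epsilon> > 0"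
    then have \<epsilon>: "\<epsilon> / 3 > 0" by simp
    obtain M1 where M1: "\<And>m n. \<lbrakk>m \<ge> M1; n \<ge> M1\<rbrakk> \<Longrightarrow> alg_norm H (\<X> m \<ominus>\<^bsub>H\<^esub> \<X> n) < \<epsilon> / 3"
      using assms \<epsilon> unfolding cauchy_in_def by meson
    obtain M2 where M2: "inverse (real (Suc M2)) < \<epsilon> / 3"
      using reals_Archimedean[OF \<epsilon>] by blast
    have small: "alg_norm H (\<X> k \<ominus>\<^bsub>H\<^esub> \<iota> (y k)) < \<epsilon> / 3" if "k \<ge> M2" for k
    proof -
      have "inverse (real (Suc k)) \<le> inverse (real (Suc M2))"
        using that by (simp add: field_simps)
      then show ?thesis using le[of k] M2 by linarith
    qed
    have "N (y m \<ominus> y n) < \<epsilon>" if mn: "m \<ge> max M1 M2" "n \<ge> max M1 M2" for m n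
    proof -
      have "N (y m \<ominus> y n) = alg_norm H (\<iota> (y m) \<ominus>\<^bsub>H\<^esub> \<iota> (y n))"
        by (simp add: \<iota>_minus \<iota>_norm y)
      also have "\<dots> \<le> alg_norm H (\<iota> (y m) \<ominus>\<^bsub>H\<^esub> \<X> m) + alg_norm H (\<X> m \<ominus>\<^bsub>H\<^esub> \<iota> (y n))"
        by (intro HN.N_triangle \<iota>_closed y \<X>)
      also have "alg_norm H (\<X> m \<ominus>\<^bsub>H\<^esub> \<iota> (y n))
          \<le> alg_norm H (\<X> m \<ominus>\<^bsub>H\<^esub> \<X> n) + alg_norm H (\<X> n \<ominus>\<^bsub>H\<^esub> \<iota> (y n))"
        by (intro HN.N_triangle \<iota>_closed y \<X>)
      finally show ?thesis
        using small[of m] small[of n] M1[of m n] mn HN.N_commute[of "\<X> m" "\<iota> (y m)"]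
        by (simp add: \<iota>_closed y \<X>)
    qed
    then show "\<exists>M. \<forall>m\<ge>M. \<forall>n\<ge>M. N (y m \<ominus> y n) < \<epsilon>" by blast
  qed
  have "converges_in H (alg_norm H) \<X> (cls y)"
    unfolding converges_in_def
  proof (rule HN.N_null_compare)
    show "\<X> k \<ominus>\<^bsub>H\<^esub> cls y \<in> carrier H" for k
      by (intro H.minus_closed \<X> cls_closed \<open>cauchy y\<close>)
    show "alg_norm H (\<X> k \<ominus>\<^bsub>H\<^esub> cls y)
        \<le> inverse (real (Suc k)) + alg_norm H (\<iota> (y k) \<ominus>\<^bsub>H\<^esub> cls y)" for k
      using HN.N_triangle[of "\<X> k" "\<iota> (y k)" "cls y"] le[of k] \<open>cauchy y\<close>
      by (simp add: \<X> \<iota>_closed cls_closed y)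
    have "(\<lambda>k. inverse (real (Suc k)) + alg_norm H (\<iota> (y k) \<ominus>\<^bsub>H\<^esub> cls y)) \<longlonglongrightarrow> 0 + 0"
      using \<iota>_converges[OF \<open>cauchy y\<close>] unfolding converges_in_def
      by (intro tendsto_add LIMSEQ_inverse_real_of_nat)
    then show "(\<lambda>k. inverse (real (Suc k)) + alg_norm H (\<iota> (y k) \<ominus>\<^bsub>H\<^esub> cls y)) \<longlonglongrightarrow> 0"
      by simp
  qed
  then show ?thesis
    using cls_closed[OF \<open>cauchy y\<close>] by blast
qed

theorem completion_cstar_algebra: "cstar_algebra H"
proof
  show "cstar_seminorm H (alg_norm H)" by (rule H_seminorm)
  fix \<X> assume "\<X> \<in> carrier H" and 0: "alg_norm H \<X> = 0"
  then obtain X where X: "cauchy X" "\<X> = cls X" by (auto elim: H_cases)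
  show "\<X> = \<zero>\<^bsub>H\<^esub>"
    unfolding X cls_zero
    using norm_tendsto[OF X(1)] X 0 by (intro cls_eqI) (auto simp: cauchy_const diff_zero cauchy_closed)
qed (rule H_complete)

end

sublocale cstar_algebra \<subseteq> seminormed_star_algebra A "alg_norm A"
  by unfold_locales (rule norm_cstar)

lemma (in cstar_algebra) limit_unique:
  assumes "x \<in> carrier A" "y \<in> carrier A" "\<And>n. X n \<in> carrier A"
    and "converges_in A (alg_norm A) X x" "converges_in A (alg_norm A) X y"
  shows "x = y"
proof -
  have "(\<lambda>n. alg_norm A (X n \<ominus> x) + alg_norm A (X n \<ominus> y)) \<longlonglongrightarrow> 0"
    using tendsto_add[OF assms(4,5)[unfolded converges_in_def]] by simp
  moreover have "alg_norm A (x \<ominus> y) \<le> alg_norm A (X n \<ominus> x) + alg_norm A (X n \<ominus> y)" for n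
    using N_triangle[of x "X n" y] N_commute[of x "X n"] assms by simp
  ultimately have "alg_norm A (x \<ominus> y) \<le> 0"
    by (intro LIMSEQ_le_const[of "\<lambda>n. alg_norm A (X n \<ominus> x) + alg_norm A (X n \<ominus> y)"]) simp_all
  then have "x \<ominus> y = \<zero>"
    using N_nonneg[of "x \<ominus> y"] assms by (intro norm_definite) auto
  then show ?thesis
    by (rule diff_eq_zeroD[OF assms(1,2)])
qed

text \<open>A contractive \<open>*\<close>-homomorphism into a \<open>C\<^sup>*\<close>-algebra extends to the completion.\<close>

theorem (in seminormed_star_algebra) completion_extend:
  assumes B: "cstar_algebra B" and \<phi>: "star_hom A B \<phi>"
    and contractive: "\<And>x. x \<in> carrier A \<Longrightarrow> alg_norm B (\<phi> x) \<le> N x"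
  shows "\<exists>\<Phi>. star_hom H B \<Phi> \<and> (\<forall>x\<in>carrier A. \<Phi> (\<iota> x) = \<phi> x)"
proof -
  interpret B: cstar_algebra B by (rule B)
  have \<phi>_closed: "\<phi> x \<in> carrier B" if "x \<in> carrier A" for x
    using \<phi> that by (simp add: star_hom_def)
  have \<phi>_ops2: "\<phi> (x \<oplus> y) = \<phi> x \<oplus>\<^bsub>B\<^esub> \<phi> y" "\<phi> (x \<otimes> y) = \<phi> x \<otimes>\<^bsub>B\<^esub> \<phi> y"
    if "x \<in> carrier A" "y \<in> carrier A" for x y
    using \<phi> that by (simp_all add: star_hom_def)
  have \<phi>_ops1: "\<phi> (c \<odot> x) = c \<odot>\<^bsub>B\<^esub> \<phi> x" "\<phi> (adj A x) = adj B (\<phi> x)"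
    if "x \<in> carrier A" for x c
    using \<phi> that by (simp_all add: star_hom_def)
  note \<phi>_ops = \<phi>_ops2 \<phi>_ops1
  have \<phi>_minus: "\<phi> (x \<ominus> y) = \<phi> x \<ominus>\<^bsub>B\<^esub> \<phi> y" if "x \<in> carrier A" "y \<in> carrier A" for x y
    using that by (simp add: minus_eq_smult B.minus_eq_smult \<phi>_ops closed \<phi>_closed)
  have \<phi>_cauchy: "B.cauchy (\<lambda>n. \<phi> (X n))" if cX: "cauchy X" for X
    unfolding cauchy_in_def
  proof (intro conjI allI impI)
    show "\<phi> (X n) \<in> carrier B" for n
      using cX by (simp add: \<phi>_closed cauchy_closed)
    fix \<epsilon> :: real assume "\<epsilon> > 0"
    then obtain M where M: "\<forall>m\<ge>M. \<forall>n\<ge>M. N (X m \<ominus> X n) < \<epsilon>"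
      using cX unfolding cauchy_in_def by meson
    have "alg_norm B (\<phi> (X m) \<ominus>\<^bsub>B\<^esub> \<phi> (X n)) \<le> N (X m \<ominus> X n)" for m n
      using contractive[of "X m \<ominus> X n"] cX by (simp add: \<phi>_minus cauchy_closed)
    with M show "\<exists>M. \<forall>m\<ge>M. \<forall>n\<ge>M. alg_norm B (\<phi> (X m) \<ominus>\<^bsub>B\<^esub> \<phi> (X n)) < \<epsilon>"
      by (meson order_le_less_trans)
  qed
  define L where "L X l \<longleftrightarrow> cauchy X \<and> l \<in> carrier B \<and> (\<lambda>n. alg_norm B (\<phi> (X n) \<ominus>\<^bsub>B\<^esub> l)) \<longlonglongrightarrow> 0"
    for X l
  have L_ex: "\<exists>l. L X l" if "cauchy X" for X
    using B.complete[OF \<phi>_cauchy[OF that]] that by (auto simp: L_def converges_in_def)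
  have L_cong: "l = l'" if XY: "L X l" "L Y l'" "cls X = cls Y" for X Y l l'
  proof -
    have c: "cauchy X" "cauchy Y"
      using XY by (auto simp: L_def)
    then have "(X, Y) \<in> R"
      using XY(3) eq_equiv_class_iff[OF star_congruence.eqv[OF R_congruence]] by simp
    then have null: "(\<lambda>n. N (X n \<ominus> Y n)) \<longlonglongrightarrow> 0"
      by (simp add: null_rel_def)
    have "(\<lambda>n. alg_norm B (\<phi> (X n) \<ominus>\<^bsub>B\<^esub> l')) \<longlonglongrightarrow> 0"
    proof (rule B.N_null_compare)
      show "\<phi> (X n) \<ominus>\<^bsub>B\<^esub> l' \<in> carrier B" for n
        using XY c by (simp add: L_def \<phi>_closed cauchy_closed)
      show "alg_norm B (\<phi> (X n) \<ominus>\<^bsub>B\<^esub> l')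
          \<le> N (X n \<ominus> Y n) + alg_norm B (\<phi> (Y n) \<ominus>\<^bsub>B\<^esub> l')" for n
        using B.N_triangle[of "\<phi> (X n)" "\<phi> (Y n)" l'] contractive[of "X n \<ominus> Y n"] XY c
        by (simp add: L_def \<phi>_closed cauchy_closed \<phi>_minus)
      show "(\<lambda>n. N (X n \<ominus> Y n) + alg_norm B (\<phi> (Y n) \<ominus>\<^bsub>B\<^esub> l')) \<longlonglongrightarrow> 0"
        using tendsto_add[OF null, of "\<lambda>n. alg_norm B (\<phi> (Y n) \<ominus>\<^bsub>B\<^esub> l')" 0] XY by (simp add: L_def)
    qed
    then show ?thesis
      using XY c
      by (intro B.limit_unique[of l l' "\<lambda>n. \<phi> (X n)"])
        (auto simp: L_def converges_in_def \<phi>_closed cauchy_closed)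
  qed
  define \<Phi> where "\<Phi> \<X> = (THE l. \<exists>X. \<X> = cls X \<and> L X l)" for \<X>
  have \<Phi>_eq: "\<Phi> (cls X) = l" if "L X l" for X l
    unfolding \<Phi>_def using that L_cong by (intro the_equality) blast+
  have L_\<Phi>: "L X (\<Phi> (cls X))" if "cauchy X" for X
    using L_ex[OF that] \<Phi>_eq by blast
  have "star_hom H B \<Phi>"
    unfolding star_hom_def
  proof (intro conjI ballI allI)
    fix \<X> assume "\<X> \<in> carrier H"
    then obtain X where X: "cauchy X" "\<X> = cls X" by (rule H_cases)
    let ?x = "\<Phi> (cls X)"
    have LX: "L X ?x" by (rule L_\<Phi>[OF X(1)])
    show "\<Phi> \<X> \<in> carrier B"
      using LX X by (simp add: L_def)
    have lim: "(\<lambda>n. alg_norm B (\<phi> (X n) \<ominus>\<^bsub>B\<^esub> ?x)) \<longlonglongrightarrow> 0" and x: "?x \<in> carrier B"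
      using LX by (simp_all add: L_def)
    have "L (\<lambda>n. adj A (X n)) (adj B ?x)"
      using lim x X
      by (simp add: L_def cauchy_adj B.closed \<phi>_ops cauchy_closed \<phi>_closed B.N_adj_diff)
    then show "\<Phi> (adj H \<X>) = adj B (\<Phi> \<X>)"
      by (simp add: X cls_adj \<Phi>_eq)
    fix c
    have "L (\<lambda>n. c \<odot> X n) (c \<odot>\<^bsub>B\<^esub> ?x)"
      using tendsto_mult_left[OF lim, of "cmod c"] x X
      by (simp add: L_def cauchy_smult B.closed \<phi>_ops cauchy_closed \<phi>_closed B.N_smult_diff)
    then show "\<Phi> (c \<odot>\<^bsub>H\<^esub> \<X>) = c \<odot>\<^bsub>B\<^esub> \<Phi> \<X>"
      by (simp add: X cls_smult \<Phi>_eq)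
  next
    fix \<X> \<Y> assume "\<X> \<in> carrier H" "\<Y> \<in> carrier H"
    then obtain X Y where X: "cauchy X" "\<X> = cls X" and Y: "cauchy Y" "\<Y> = cls Y"
      by (metis H_cases)
    let ?x = "\<Phi> (cls X)" and ?y = "\<Phi> (cls Y)"
    have lx: "(\<lambda>n. alg_norm B (\<phi> (X n) \<ominus>\<^bsub>B\<^esub> ?x)) \<longlonglongrightarrow> 0" and x: "?x \<in> carrier B"
      using L_\<Phi>[OF X(1)] by (simp_all add: L_def)
    have ly: "(\<lambda>n. alg_norm B (\<phi> (Y n) \<ominus>\<^bsub>B\<^esub> ?y)) \<longlonglongrightarrow> 0" and y: "?y \<in> carrier B"
      using L_\<Phi>[OF Y(1)] by (simp_all add: L_def)
    note cl = X(1) Y(1) x y cauchy_closed \<phi>_closed B.closed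
    have "(\<lambda>n. alg_norm B (\<phi> (X n \<oplus> Y n) \<ominus>\<^bsub>B\<^esub> (?x \<oplus>\<^bsub>B\<^esub> ?y))) \<longlonglongrightarrow> 0"
    proof (rule B.N_null_compare)
      show "alg_norm B (\<phi> (X n \<oplus> Y n) \<ominus>\<^bsub>B\<^esub> (?x \<oplus>\<^bsub>B\<^esub> ?y))
          \<le> alg_norm B (\<phi> (X n) \<ominus>\<^bsub>B\<^esub> ?x) + alg_norm B (\<phi> (Y n) \<ominus>\<^bsub>B\<^esub> ?y)" for n
        by (simp add: \<phi>_ops cl B.N_add_diff)
      show "(\<lambda>n. alg_norm B (\<phi> (X n) \<ominus>\<^bsub>B\<^esub> ?x) + alg_norm B (\<phi> (Y n) \<ominus>\<^bsub>B\<^esub> ?y)) \<longlonglongrightarrow> 0"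
        using tendsto_add[OF lx ly] by simp
    qed (simp add: cl)
    then have "L (\<lambda>n. X n \<oplus> Y n) (?x \<oplus>\<^bsub>B\<^esub> ?y)"
      by (simp add: L_def cl cauchy_add)
    then show "\<Phi> (\<X> \<oplus>\<^bsub>H\<^esub> \<Y>) = \<Phi> \<X> \<oplus>\<^bsub>B\<^esub> \<Phi> \<Y>"
      by (simp add: X Y cls_add \<Phi>_eq)
    obtain K where K: "K > 0" "\<And>n. alg_norm B (\<phi> (X n)) \<le> K"
      using B.cauchy_bound[OF \<phi>_cauchy[OF X(1)]] by auto
    have "(\<lambda>n. alg_norm B (\<phi> (X n \<otimes> Y n) \<ominus>\<^bsub>B\<^esub> ?x \<otimes>\<^bsub>B\<^esub> ?y)) \<longlonglongrightarrow> 0"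
    proof (rule B.N_null_compare)
      show "alg_norm B (\<phi> (X n \<otimes> Y n) \<ominus>\<^bsub>B\<^esub> ?x \<otimes>\<^bsub>B\<^esub> ?y)
          \<le> K * alg_norm B (\<phi> (Y n) \<ominus>\<^bsub>B\<^esub> ?y) + alg_norm B (\<phi> (X n) \<ominus>\<^bsub>B\<^esub> ?x) * alg_norm B ?y" for n
      proof -
        have "alg_norm B (\<phi> (X n \<otimes> Y n) \<ominus>\<^bsub>B\<^esub> ?x \<otimes>\<^bsub>B\<^esub> ?y)
            \<le> alg_norm B (\<phi> (X n)) * alg_norm B (\<phi> (Y n) \<ominus>\<^bsub>B\<^esub> ?y)
              + alg_norm B (\<phi> (X n) \<ominus>\<^bsub>B\<^esub> ?x) * alg_norm B ?y"
          by (simp add: \<phi>_ops cl B.N_mult_diff)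
        moreover have "alg_norm B (\<phi> (X n)) * alg_norm B (\<phi> (Y n) \<ominus>\<^bsub>B\<^esub> ?y)
            \<le> K * alg_norm B (\<phi> (Y n) \<ominus>\<^bsub>B\<^esub> ?y)"
          by (rule mult_right_mono[OF K(2)]) (simp add: B.N_nonneg cl)
        ultimately show ?thesis by linarith
      qed
      have "(\<lambda>n. K * alg_norm B (\<phi> (Y n) \<ominus>\<^bsub>B\<^esub> ?y)
          + alg_norm B (\<phi> (X n) \<ominus>\<^bsub>B\<^esub> ?x) * alg_norm B ?y) \<longlonglongrightarrow> K * 0 + 0 * alg_norm B ?y"
        by (intro tendsto_intros lx ly)
      then show "(\<lambda>n. K * alg_norm B (\<phi> (Y n) \<ominus>\<^bsub>B\<^esub> ?y)
          + alg_norm B (\<phi> (X n) \<ominus>\<^bsub>B\<^esub> ?x) * alg_norm B ?y) \<longlonglongrightarrow> 0"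
        by simp
    qed (simp add: cl closed)
    then have "L (\<lambda>n. X n \<otimes> Y n) (?x \<otimes>\<^bsub>B\<^esub> ?y)"
      by (simp add: L_def cl cauchy_mult)
    then show "\<Phi> (\<X> \<otimes>\<^bsub>H\<^esub> \<Y>) = \<Phi> \<X> \<otimes>\<^bsub>B\<^esub> \<Phi> \<Y>"
      by (simp add: X Y cls_mult \<Phi>_eq)
  qed
  moreover have "\<Phi> (\<iota> x) = \<phi> x" if "x \<in> carrier A" for x
    unfolding \<iota>_cls using that
    by (intro \<Phi>_eq) (simp add: L_def cauchy_const \<phi>_closed B.diff_self B.N_zero)
  ultimately show ?thesis by blast
qed


section \<open>Facts on the free \<open>*\<close>-algebra\<close>

lemma poly_mapping_decomp:
  "x = (\<Sum>w\<in>Poly_Mapping.keys x. Poly_Mapping.single w (Poly_Mapping.lookup x w))"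
proof (rule poly_mapping_eqI)
  fix k
  have "(\<Sum>w\<in>Poly_Mapping.keys x. Poly_Mapping.lookup x w when w = k) =
        (if k \<in> Poly_Mapping.keys x then Poly_Mapping.lookup x k else 0)"
    by (simp add: when_def)
  then show "Poly_Mapping.lookup x k =
      Poly_Mapping.lookup (\<Sum>w\<in>Poly_Mapping.keys x. Poly_Mapping.single w (Poly_Mapping.lookup x w)) k"
    by (simp add: lookup_sum lookup_single in_keys_iff)
qed

lemma poly_mapping_linear_induct [case_names zero single add]:
  fixes x :: "'a \<Rightarrow>\<^sub>0 complex"
  assumes "P 0" "\<And>w c. w \<in> Poly_Mapping.keys x \<Longrightarrow> P (Poly_Mapping.single w c)"
    "\<And>x y. P x \<Longrightarrow> P y \<Longrightarrow> P (x + y)"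
  shows "P x"
proof -
  have "P (\<Sum>w\<in>S. Poly_Mapping.single w (Poly_Mapping.lookup x w))"
    if "finite S" "S \<subseteq> Poly_Mapping.keys x" for S
    using that by (induction S) (auto intro: assms)
  from this[OF finite_keys subset_refl] show ?thesis
    using poly_mapping_decomp[of x] by simp
qed

abbreviation scal :: "complex \<Rightarrow> ('v, 'e) free_alg \<Rightarrow> ('v, 'e) free_alg" where
  "scal c x \<equiv> Poly_Mapping.single 0 c * x"

lemma scal_single: "scal c (Poly_Mapping.single w d) = Poly_Mapping.single w (c * d)"
  by (simp add: mult_single)

lemma scal_commute: "x * Poly_Mapping.single 0 c = scal c x"
  by (induction x rule: poly_mapping_linear_induct) (simp_all add: mult_single algebra_simps)

lemma scal_mult_right: "x * scal c y = scal c (x * y)"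
  by (metis mult.assoc scal_commute)

lemma scal_uminus: "scal (-1) x = - x"
  by (simp add: single_uminus)

lemma generator_star_star [simp]: "generator_star (generator_star g) = g"
  by (cases g) auto

lemma monomial_star_star [simp]: "monomial_star (monomial_star w) = w"
  by (simp add: monomial_star_def rev_map comp_def)

lemma inj_monomial_star [simp]: "inj monomial_star"
  by (metis injI monomial_star_star)

lemma monomial_star_add: "monomial_star (u + w) = monomial_star w + monomial_star u"
  by (simp add: monomial_star_def plus_monomial_def)

lemma monomial_star_zero [simp]: "monomial_star 0 = 0"
  by (simp add: monomial_star_def zero_monomial_def)

lemma lookup_free_star: "Poly_Mapping.lookup (free_star x) w = cnj (Poly_Mapping.lookup x (monomial_star w))"
  by (simp add: free_star_def map.rep_eq map_key.rep_eq when_def)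

lemma free_star_add: "free_star (x + y) = free_star x + free_star y"
  by (rule poly_mapping_eqI) (simp add: lookup_free_star lookup_add)

lemma free_star_zero [simp]: "free_star 0 = 0"
  by (rule poly_mapping_eqI) (simp add: lookup_free_star)

lemma free_star_single: "free_star (Poly_Mapping.single w c) = Poly_Mapping.single (monomial_star w) (cnj c)"
  by (rule poly_mapping_eqI) (auto simp: lookup_free_star lookup_single when_def)

lemma free_star_star [simp]: "free_star (free_star x) = x"
  by (rule poly_mapping_eqI) (simp add: lookup_free_star)

lemma free_star_mult: "free_star (x * y) = free_star y * free_star x"
proof (induction x rule: poly_mapping_linear_induct)
  case (single u c)
  show ?case
    by (induction y rule: poly_mapping_linear_induct)
      (simp_all add: free_star_add free_star_single mult_single monomial_star_add distrib_left
        distrib_right mult.commute)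
qed (simp_all add: free_star_add distrib_left distrib_right)

lemma free_star_scal: "free_star (scal c x) = scal (cnj c) (free_star x)"
  by (simp add: free_star_mult free_star_single scal_commute)

lemma free_star_uminus: "free_star (- x) = - free_star x"
  using free_star_scal[of "-1" x] by (simp add: scal_uminus)

lemma free_star_diff: "free_star (x - y) = free_star x - free_star y"
  using free_star_add[of x "- y"] by (simp add: free_star_uminus)

lemma free_star_sum: "free_star (sum f S) = (\<Sum>i\<in>S. free_star (f i))"
  by (induction S rule: infinite_finite_induct) (simp_all add: free_star_add)

lemma free_star_gen: "free_star (gen g) = gen (generator_star g)"
  by (simp add: gen_def free_star_single monomial_star_def)

context
  fixes E :: "('v, 'e) pre_digraph"
begin

abbreviation "Fr \<equiv> free_star_algebra E"

definition "good_words = {w. letters w \<noteq> [] \<and> set (letters w) \<subseteq> generators E}"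

lemma Fr_simps [simp]:
  "x \<otimes>\<^bsub>Fr\<^esub> y = x * y" "x \<oplus>\<^bsub>Fr\<^esub> y = x + y" "\<zero>\<^bsub>Fr\<^esub> = 0" "c \<odot>\<^bsub>Fr\<^esub> x = scal c x"
  "adj Fr x = free_star x"
  by (simp_all add: free_star_algebra_def)

lemma Fr_carrier: "x \<in> carrier Fr \<longleftrightarrow> Poly_Mapping.keys x \<subseteq> good_words"
  by (auto simp: free_star_algebra_def good_words_def)

lemma good_add: "u \<in> good_words \<Longrightarrow> w \<in> good_words \<Longrightarrow> u + w \<in> good_words"
  by (auto simp: good_words_def plus_monomial_def)

lemma generator_star_generators: "g \<in> generators E \<Longrightarrow> generator_star g \<in> generators E"
  by (auto simp: generators_def)

lemma good_star: "w \<in> good_words \<Longrightarrow> monomial_star w \<in> good_words"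
  by (auto simp: good_words_def monomial_star_def dest: generator_star_generators)

lemma Fr_zero: "0 \<in> carrier Fr"
  by (simp add: Fr_carrier)

lemma Fr_add: "x \<in> carrier Fr \<Longrightarrow> y \<in> carrier Fr \<Longrightarrow> x + y \<in> carrier Fr"
  using keys_add[of x y] by (auto simp: Fr_carrier)

lemma Fr_mult: "x \<in> carrier Fr \<Longrightarrow> y \<in> carrier Fr \<Longrightarrow> x * y \<in> carrier Fr"
  using keys_mult[of x y] good_add by (fastforce simp: Fr_carrier)

lemma Fr_single: "w \<in> good_words \<Longrightarrow> Poly_Mapping.single w c \<in> carrier Fr"
  by (simp add: Fr_carrier)

lemma Fr_scal: "x \<in> carrier Fr \<Longrightarrow> scal c x \<in> carrier Fr"
  using keys_mult[of "Poly_Mapping.single 0 c" x] by (auto simp: Fr_carrier split: if_splits)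

lemma Fr_star: "x \<in> carrier Fr \<Longrightarrow> free_star x \<in> carrier Fr"
  unfolding Fr_carrier
  by (metis complex_cnj_zero good_star in_keys_iff lookup_free_star monomial_star_star subset_iff)

lemma Fr_uminus: "x \<in> carrier Fr \<Longrightarrow> - x \<in> carrier Fr"
  by (simp add: Fr_carrier)

lemma Fr_diff: "x \<in> carrier Fr \<Longrightarrow> y \<in> carrier Fr \<Longrightarrow> x - y \<in> carrier Fr"
  using Fr_add[of x "- y"] Fr_uminus[of y] by simp

lemma Fr_gen: "g \<in> generators E \<Longrightarrow> gen g \<in> carrier Fr"
  by (simp add: gen_def Fr_single good_words_def)

lemma Fr_sum: "(\<And>i. i \<in> S \<Longrightarrow> f i \<in> carrier Fr) \<Longrightarrow> sum f S \<in> carrier Fr"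
  by (induction S rule: infinite_finite_induct) (auto simp: Fr_zero Fr_add)

lemmas Fr_closed = Fr_zero Fr_add Fr_mult Fr_scal Fr_star Fr_diff Fr_gen Fr_sum

lemma Fr_induct [consumes 1, case_names zero single add]:
  assumes "x \<in> carrier Fr" "P 0" "\<And>w c. w \<in> good_words \<Longrightarrow> P (Poly_Mapping.single w c)"
    "\<And>x y. \<lbrakk>x \<in> carrier Fr; y \<in> carrier Fr; P x; P y\<rbrakk> \<Longrightarrow> P (x + y)"
  shows "P x"
proof -
  have sub: "Poly_Mapping.keys x \<subseteq> good_words"
    using assms(1) by (simp add: Fr_carrier)
  have "x \<in> carrier Fr \<and> P x"
  proof (rule poly_mapping_linear_induct[of "\<lambda>y. y \<in> carrier Fr \<and> P y"])
    fix w c assume "w \<in> Poly_Mapping.keys x"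
    then show "Poly_Mapping.single w c \<in> carrier Fr \<and> P (Poly_Mapping.single w c)"
      using sub assms(3) Fr_single by blast
  qed (use assms(2,4) Fr_zero Fr_add in blast)+
  then show ?thesis ..
qed

theorem free_star_algebra: "star_algebra Fr"
proof (rule star_algebraI)
  show "star_algebra_axioms Fr"
  proof
    fix x y c d
    show "(c * d) \<odot>\<^bsub>Fr\<^esub> x = c \<odot>\<^bsub>Fr\<^esub> (d \<odot>\<^bsub>Fr\<^esub> x)"
      by (simp add: mult_single flip: mult.assoc)
    show "x \<otimes>\<^bsub>Fr\<^esub> (c \<odot>\<^bsub>Fr\<^esub> y) = c \<odot>\<^bsub>Fr\<^esub> (x \<otimes>\<^bsub>Fr\<^esub> y)"
      using scal_mult_right by simp
    show "adj Fr (c \<odot>\<^bsub>Fr\<^esub> x) = cnj c \<odot>\<^bsub>Fr\<^esub> adj Fr x"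
      by (simp only: Fr_simps free_star_scal)
  qed (simp_all add: Fr_closed distrib_left distrib_right mult.assoc single_add free_star_add free_star_mult)
qed (simp_all add: Fr_closed scal_uminus add.assoc add.commute)

end


section \<open>Leavitt path algebras are \<open>*\<close>-algebras\<close>

lemma leavitt_ideal_star: "x \<in> leavitt_ideal E \<Longrightarrow> free_star x \<in> leavitt_ideal E"
proof (induction rule: leavitt_ideal.induct)
  case (relator x)
  then have "free_star x \<in> leavitt_relators E"
    unfolding leavitt_relators_def
    by (elim UnE CollectE exE conjE; simp add: free_star_diff free_star_mult free_star_gen free_star_sum;
        metis)
  then show ?case by (rule leavitt_ideal.relator)
next
  case (smult x c)
  then show ?case
    using leavitt_ideal.smult[OF smult.IH, of "cnj c"] by (simp add: free_star_scal del: free_star_mult)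
next
  case (mult_left x a)
  then show ?case
    using leavitt_ideal.mult_right[OF mult_left.IH, of "free_star a"] by (simp add: free_star_mult Fr_star)
next
  case (mult_right x a)
  then show ?case
    using leavitt_ideal.mult_left[OF mult_right.IH, of "free_star a"] by (simp add: free_star_mult Fr_star)
qed (auto simp: free_star_add intro: leavitt_ideal.intros)

lemma leavitt_congruence: "star_congruence (free_star_algebra E) (leavitt_rel E)"
proof -
  interpret star_algebra "free_star_algebra E" by (rule free_star_algebra)
  have uminus: "- x \<in> leavitt_ideal E" if "x \<in> leavitt_ideal E" for x
    using leavitt_ideal.smult[OF that, of "-1"] by (simp add: scal_uminus)
  show ?thesis
  proof
    show "equiv (carrier (Fr E)) (leavitt_rel E)"
    proof (rule equivI)
      show "leavitt_rel E \<subseteq> carrier (Fr E) \<times> carrier (Fr E)"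
        by (auto simp: leavitt_rel_def)
      show "refl_on (carrier (Fr E)) (leavitt_rel E)"
        by (auto simp: leavitt_rel_def refl_on_def leavitt_ideal.zero)
      show "sym (leavitt_rel E)"
        using uminus by (fastforce simp: leavitt_rel_def sym_def)
      show "trans (leavitt_rel E)"
        using leavitt_ideal.add by (fastforce simp: leavitt_rel_def trans_def)
    qed
  next
    fix x x' y y' assume xy: "(x, x') \<in> leavitt_rel E" "(y, y') \<in> leavitt_rel E"
    have "(x - x') + (y - y') = (x + y) - (x' + y')"
      by simp
    with xy have "(x + y) - (x' + y') \<in> leavitt_ideal E"
      using leavitt_ideal.add[of "x - x'" E "y - y'"] by (simp only: leavitt_rel_def) auto
    then show "(x \<oplus>\<^bsub>Fr E\<^esub> y, x' \<oplus>\<^bsub>Fr E\<^esub> y') \<in> leavitt_rel E"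
      using xy by (simp add: leavitt_rel_def Fr_add)
    have "x * y - x' * y' = (x - x') * y + x' * (y - y')"
      by (simp add: algebra_simps)
    then show "(x \<otimes>\<^bsub>Fr E\<^esub> y, x' \<otimes>\<^bsub>Fr E\<^esub> y') \<in> leavitt_rel E"
      using xy leavitt_ideal.add[OF leavitt_ideal.mult_right[of "x - x'" E y]
          leavitt_ideal.mult_left[of "y - y'" E x']]
      by (simp add: leavitt_rel_def Fr_mult)
  next
    fix x x' c assume xy: "(x, x') \<in> leavitt_rel E"
    have "scal c x - scal c x' = scal c (x - x')"
      by (simp add: algebra_simps)
    then show "(c \<odot>\<^bsub>Fr E\<^esub> x, c \<odot>\<^bsub>Fr E\<^esub> x') \<in> leavitt_rel E"
      using xy leavitt_ideal.smult[of "x - x'" E c] by (simp add: leavitt_rel_def Fr_scal)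
    show "(adj (Fr E) x, adj (Fr E) x') \<in> leavitt_rel E"
      using xy leavitt_ideal_star[of "x - x'" E] by (simp add: leavitt_rel_def Fr_star free_star_diff)
  qed
qed

theorem leavitt_path_star_algebra: "star_algebra (leavitt_path_algebra E)"
  unfolding leavitt_path_algebra_def by (rule star_congruence.quot_star_algebra[OF leavitt_congruence])


section \<open>The universal seminorm\<close>

lemma ck_relators_carrier:
  assumes "wf_digraph E" "x \<in> ck_relators E"
  shows "x \<in> carrier (Fr E)"
proof -
  interpret wf_digraph E by fact
  have "vert_gen v \<in> carrier (Fr E)" if "v \<in> verts E" for v
    using that by (auto intro!: Fr_gen simp: generators_def)
  moreover have "edge_gen e \<in> carrier (Fr E)" "ghost_gen e \<in> carrier (Fr E)" if "e \<in> arcs E" for e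
    using that by (auto intro!: Fr_gen simp: generators_def)
  ultimately show ?thesis
    using assms(2) unfolding ck_relators_def
    by (auto simp: regular_vertex_def intro!: Fr_mult Fr_diff Fr_sum)
qed

lemma free_minus:
  assumes "x \<in> carrier (Fr E)" "y \<in> carrier (Fr E)"
  shows "x \<ominus>\<^bsub>Fr E\<^esub> y = x - y"
  using star_algebra.minus_eq_smult[OF free_star_algebra assms(2)] by (simp add: scal_uminus)

lemma ck_seminorm_gen_le:
  assumes E: "wf_digraph E" and q: "q \<in> ck_seminorms E" and g: "g \<in> generators E"
  shows "q (gen g) \<le> 1"
proof -
  interpret wf_digraph E by fact
  interpret seminormed_star_algebra "Fr E" q
    using q by (simp add: seminormed_star_algebra_def seminormed_star_algebra_axioms_def
        free_star_algebra ck_seminorms_def)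
  have rel: "q x = 0" if "x \<in> ck_relators E" for x
    using q that by (simp add: ck_seminorms_def)
  have eq: "q x = q y" if "x - y \<in> ck_relators E" "x \<in> carrier (Fr E)" "y \<in> carrier (Fr E)" for x y
    using N_abs_diff[of x y] that rel by (simp add: free_minus)
  have le1: "t \<le> 1" if "t\<^sup>2 \<le> t" "0 \<le> t" for t :: real
    using that by (metis linorder_not_le mult.right_neutral mult_less_cancel_left_pos power2_eq_square
        order_less_trans zero_less_one)
  have v: "q (vert_gen v) \<le> 1" if "v \<in> verts E" for v
  proof -
    have c: "vert_gen v \<in> carrier (Fr E)"
      using that by (auto intro!: Fr_gen simp: generators_def)
    have "vert_gen v * vert_gen v - vert_gen v \<in> ck_relators E"
      unfolding ck_relators_def using that by blast
    then have "q (vert_gen v * vert_gen v) = q (vert_gen v)"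
      using c by (intro eq Fr_mult)
    then have "(q (vert_gen v))\<^sup>2 = q (vert_gen v)"
      using N_cstar[OF c] by (simp add: free_star_gen)
    then show ?thesis
      using N_nonneg[OF c] by (intro le1) auto
  qed
  have e: "q (edge_gen e) \<le> 1" if "e \<in> arcs E" for e
  proof -
    have c: "edge_gen e \<in> carrier (Fr E)" "ghost_gen e \<in> carrier (Fr E)"
      "vert_gen (head E e) \<in> carrier (Fr E)"
      using that by (auto intro!: Fr_gen simp: generators_def)
    have "ghost_gen e * edge_gen e - vert_gen (head E e) \<in> ck_relators E"
      unfolding ck_relators_def using that by blast
    then have "q (ghost_gen e * edge_gen e) = q (vert_gen (head E e))"
      using c by (intro eq Fr_mult)
    then have "(q (edge_gen e))\<^sup>2 \<le> 1"
      using N_cstar[OF c(1)] v[of "head E e"] that by (simp add: free_star_gen)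
    then show ?thesis
      by (simp add: power2_le_iff_abs_le abs_square_le_1)
  qed
  have "q (ghost_gen e) \<le> 1" if "e \<in> arcs E" for e
    using e[OF that] N_adj[of "edge_gen e"] that Fr_gen[of "Edge e" E]
    by (simp add: free_star_gen generators_def)
  with v e g show ?thesis
    by (auto simp: generators_def)
qed

lemma ck_seminorm_word_le:
  assumes E: "wf_digraph E" and q: "q \<in> ck_seminorms E"
  shows "\<lbrakk>ws \<noteq> []; set ws \<subseteq> generators E\<rbrakk> \<Longrightarrow> q (Poly_Mapping.single (Monomial ws) 1) \<le> 1"
proof (induction ws rule: list_nonempty_induct)
  case (single g)
  then show ?case
    using ck_seminorm_gen_le[OF E q, of g] by (simp add: gen_def)
next
  case (cons g ws)
  interpret seminormed_star_algebra "Fr E" q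
    using q by (simp add: seminormed_star_algebra_def seminormed_star_algebra_axioms_def
        free_star_algebra ck_seminorms_def)
  let ?w = "Poly_Mapping.single (Monomial ws) 1 :: ('a, 'b) free_alg"
  have c: "gen g \<in> carrier (Fr E)" "?w \<in> carrier (Fr E)"
    using cons by (auto intro!: Fr_gen Fr_single simp: good_words_def)
  have "Poly_Mapping.single (Monomial (g # ws)) 1 = gen g * ?w"
    by (simp add: gen_def mult_single plus_monomial_def)
  then have "q (Poly_Mapping.single (Monomial (g # ws)) 1) \<le> q (gen g) * q ?w"
    using N_mult[OF c] by simp
  also have "\<dots> \<le> 1 * 1"
    using ck_seminorm_gen_le[OF E q, of g] cons c by (intro mult_mono N_nonneg) auto
  finally show ?case by simp
qed

lemma ck_seminorms_bounded:
  assumes E: "wf_digraph E" and x: "x \<in> carrier (Fr E)"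
  shows "\<exists>K. \<forall>q\<in>ck_seminorms E. q x \<le> K"
  using x
proof (induction x rule: Fr_induct)
  case zero
  have "q 0 = 0" if "q \<in> ck_seminorms E" for q
    using seminormed_star_algebra.N_zero[of "Fr E" q] that
    by (simp add: seminormed_star_algebra_def seminormed_star_algebra_axioms_def
        free_star_algebra ck_seminorms_def)
  then show ?case by fastforce
next
  case (single w c)
  have "q (Poly_Mapping.single w c) \<le> cmod c" if q: "q \<in> ck_seminorms E" for q
  proof -
    have w: "w = Monomial (letters w)" by simp
    have "q (scal c (Poly_Mapping.single w 1)) = cmod c * q (Poly_Mapping.single w 1)"
      using q single by (simp add: ck_seminorms_def cstar_seminorm_def Fr_single)
    moreover have "q (Poly_Mapping.single w 1) \<le> 1"
      using ck_seminorm_word_le[OF E q, of "letters w"] single by (simp add: good_words_def)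
    ultimately show ?thesis
      by (simp add: scal_single mult_left_le)
  qed
  then show ?case by blast
next
  case (add x y)
  then obtain K L where "\<forall>q\<in>ck_seminorms E. q x \<le> K" "\<forall>q\<in>ck_seminorms E. q y \<le> L"
    by blast
  moreover have "q (x + y) \<le> q x + q y" if "q \<in> ck_seminorms E" for q
    using that add by (simp add: ck_seminorms_def cstar_seminorm_def)
  ultimately have "\<forall>q\<in>ck_seminorms E. q (x + y) \<le> K + L"
    by (meson add_mono order_trans)
  then show ?case by blast
qed

lemma ck_seminorms_zero: "(\<lambda>_. 0) \<in> ck_seminorms E"
  by (simp add: ck_seminorms_def cstar_seminorm_def)

lemma ck_norm_upper:
  assumes "wf_digraph E" "x \<in> carrier (Fr E)" "q \<in> ck_seminorms E"
  shows "q x \<le> ck_norm E x"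
proof -
  obtain K where "\<forall>q\<in>ck_seminorms E. q x \<le> K"
    using ck_seminorms_bounded[OF assms(1,2)] by blast
  then show ?thesis
    unfolding ck_norm_def using assms(3) by (intro cSUP_upper bdd_aboveI2) auto
qed

lemma ck_norm_least: "(\<And>q. q \<in> ck_seminorms E \<Longrightarrow> q x \<le> K) \<Longrightarrow> ck_norm E x \<le> K"
  unfolding ck_norm_def using ck_seminorms_zero by (intro cSUP_least) auto

lemma ck_norm_seminorm:
  assumes E: "wf_digraph E"
  shows "cstar_seminorm (Fr E) (ck_norm E)"
proof -
  have S: "cstar_seminorm (Fr E) q" if "q \<in> ck_seminorms E" for q
    using that by (simp add: ck_seminorms_def)
  note upper = ck_norm_upper[OF E]
  have nonneg: "0 \<le> ck_norm E x" if "x \<in> carrier (Fr E)" for x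
    using upper[OF that ck_seminorms_zero] by simp
  have smult_le: "ck_norm E (scal c x) \<le> cmod c * ck_norm E x" if "x \<in> carrier (Fr E)" for c x
  proof (rule ck_norm_least)
    fix q assume q: "q \<in> ck_seminorms E"
    then show "q (scal c x) \<le> cmod c * ck_norm E x"
      using S[OF q] upper[OF that q] that by (simp add: cstar_seminorm_def mult_left_mono)
  qed
  show ?thesis
    unfolding cstar_seminorm_def
  proof (intro conjI ballI allI)
    fix x assume x: "x \<in> carrier (Fr E)"
    show "0 \<le> ck_norm E x" using nonneg[OF x] .
    have xx: "free_star x * x \<in> carrier (Fr E)"
      using x by (intro Fr_mult Fr_star)
    have sq: "q (free_star x * x) = (q x)\<^sup>2" "0 \<le> q x" if "q \<in> ck_seminorms E" for q
      using S[OF that] x by (simp_all add: cstar_seminorm_def)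
    have "ck_norm E (free_star x * x) \<le> (ck_norm E x)\<^sup>2"
    proof (rule ck_norm_least)
      fix q assume q: "q \<in> ck_seminorms E"
      then show "q (free_star x * x) \<le> (ck_norm E x)\<^sup>2"
        unfolding sq(1)[OF q] by (intro power_mono upper[OF x q] sq(2)[OF q])
    qed
    moreover have "ck_norm E x \<le> sqrt (ck_norm E (free_star x * x))"
    proof (rule ck_norm_least)
      fix q assume "q \<in> ck_seminorms E"
      then show "q x \<le> sqrt (ck_norm E (free_star x * x))"
        using sq upper[OF xx] by (metis real_le_rsqrt)
    qed
    then have "(ck_norm E x)\<^sup>2 \<le> ck_norm E (free_star x * x)"
      using nonneg[OF x] nonneg[OF xx] by (metis power_mono real_sqrt_pow2)
    ultimately show "ck_norm E (adj (Fr E) x \<otimes>\<^bsub>Fr E\<^esub> x) = (ck_norm E x)\<^sup>2"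
      by simp
    fix c
    show "ck_norm E (c \<odot>\<^bsub>Fr E\<^esub> x) = cmod c * ck_norm E x"
    proof (cases "c = 0")
      case True
      then show ?thesis
        using smult_le[OF x, of 0] nonneg[OF Fr_zero] by simp
    next
      case False
      have "scal (inverse c) (scal c x) = x"
        using False by (simp add: mult_single flip: mult.assoc)
      then have "ck_norm E x \<le> inverse (cmod c) * ck_norm E (scal c x)"
        using smult_le[OF Fr_scal[OF x], of "inverse c" c] by (simp add: norm_inverse)
      then have "cmod c * ck_norm E x \<le> ck_norm E (scal c x)"
        using False by (simp add: field_simps)
      then show ?thesis
        using smult_le[OF x, of c] by simp
    qed
  next
    fix x y assume x: "x \<in> carrier (Fr E)" and y: "y \<in> carrier (Fr E)"
    show "ck_norm E (x \<oplus>\<^bsub>Fr E\<^esub> y) \<le> ck_norm E x + ck_norm E y"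
    proof (rule ck_norm_least)
      fix q assume q: "q \<in> ck_seminorms E"
      have "q (x + y) \<le> q x + q y"
        using S[OF q] x y by (simp add: cstar_seminorm_def)
      then show "q (x \<oplus>\<^bsub>Fr E\<^esub> y) \<le> ck_norm E x + ck_norm E y"
        using upper[OF x q] upper[OF y q] by simp
    qed
    show "ck_norm E (x \<otimes>\<^bsub>Fr E\<^esub> y) \<le> ck_norm E x * ck_norm E y"
    proof (rule ck_norm_least)
      fix q assume q: "q \<in> ck_seminorms E"
      have "q (x * y) \<le> q x * q y" "0 \<le> q x" "0 \<le> q y"
        using S[OF q] x y by (simp_all add: cstar_seminorm_def)
      moreover have "q x * q y \<le> ck_norm E x * ck_norm E y"
        using upper[OF x q] upper[OF y q] calculation nonneg x y by (intro mult_mono) auto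
      ultimately show "q (x \<otimes>\<^bsub>Fr E\<^esub> y) \<le> ck_norm E x * ck_norm E y"
        by simp
    qed
  qed
qed

lemma ck_norm_relator:
  assumes "x \<in> ck_relators E"
  shows "ck_norm E x = 0"
proof -
  have "(\<lambda>q. q x) ` ck_seminorms E = {0}"
    using assms ck_seminorms_zero by (fastforce simp: ck_seminorms_def)
  then show ?thesis by (simp add: ck_norm_def)
qed

lemma seminormed_free: "wf_digraph E \<Longrightarrow> seminormed_star_algebra (Fr E) (ck_norm E)"
  by (simp add: seminormed_star_algebra_def seminormed_star_algebra_axioms_def free_star_algebra
      ck_norm_seminorm)


section \<open>Evaluation of the free \<open>*\<close>-algebra\<close>

fun word_eval :: "('a, 'm) star_algebra_scheme \<Rightarrow> ('g \<Rightarrow> 'a) \<Rightarrow> 'g list \<Rightarrow> 'a" where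
  "word_eval A m [] = \<zero>\<^bsub>A\<^esub>"
| "word_eval A m [g] = m g"
| "word_eval A m (g # h # ws) = m g \<otimes>\<^bsub>A\<^esub> word_eval A m (h # ws)"

definition free_eval :: "('a, 'm) star_algebra_scheme \<Rightarrow> (('v, 'e) generator \<Rightarrow> 'a) \<Rightarrow> ('v, 'e) free_alg \<Rightarrow> 'a" where
  "free_eval A m x = (\<Oplus>\<^bsub>A\<^esub>w\<in>Poly_Mapping.keys x. Poly_Mapping.lookup x w \<odot>\<^bsub>A\<^esub> word_eval A m (letters w))"

locale generator_assignment = star_algebra A for A (structure) +
  fixes E :: "('v, 'e) pre_digraph" and m :: "('v, 'e) generator \<Rightarrow> 'a"
  assumes m_closed: "g \<in> generators E \<Longrightarrow> m g \<in> carrier A"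
    and m_star: "g \<in> generators E \<Longrightarrow> m (generator_star g) = adj A (m g)"
begin

lemma word_eval_closed: "set ws \<subseteq> generators E \<Longrightarrow> word_eval A m ws \<in> carrier A"
proof (induction ws)
  case (Cons g ws)
  then show ?case by (cases ws) (auto intro: m_closed closed)
qed simp

lemma word_eval_append:
  "\<lbrakk>ws \<noteq> []; us \<noteq> []; set ws \<subseteq> generators E; set us \<subseteq> generators E\<rbrakk>
    \<Longrightarrow> word_eval A m (ws @ us) = word_eval A m ws \<otimes> word_eval A m us"
proof (induction ws rule: list_nonempty_induct)
  case (single g)
  then show ?case by (cases us) auto
next
  case (cons g ws)
  then obtain h ws' where ws: "ws = h # ws'" by (cases ws) auto
  then show ?case
    using cons word_eval_closed[of ws] word_eval_closed[of us] m_closed[of g]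
    by (simp add: mult_assoc)
qed

lemma word_eval_star:
  "\<lbrakk>ws \<noteq> []; set ws \<subseteq> generators E\<rbrakk>
    \<Longrightarrow> word_eval A m (rev (map generator_star ws)) = adj A (word_eval A m ws)"
proof (induction ws rule: list_nonempty_induct)
  case (single g)
  then show ?case by (simp add: m_star)
next
  case (cons g ws)
  then obtain h ws' where ws: "ws = h # ws'" by (cases ws) auto
  have "word_eval A m (rev (map generator_star (g # ws)))
      = word_eval A m (rev (map generator_star ws)) \<otimes> word_eval A m [generator_star g]"
    using cons word_eval_append[of "rev (map generator_star ws)" "[generator_star g]"]
    by (auto intro: generator_star_generators)
  also have "\<dots> = adj A (word_eval A m ws) \<otimes> adj A (m g)"
    using cons by (simp add: m_star)
  also have "\<dots> = adj A (word_eval A m (g # ws))"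
    using cons word_eval_closed[of ws] m_closed[of g] unfolding ws by (simp add: adj_mult)
  finally show ?case .
qed

lemma term_closed: "w \<in> good_words E \<Longrightarrow> c \<odot> word_eval A m (letters w) \<in> carrier A"
  by (intro closed word_eval_closed) (auto simp: good_words_def)

lemma free_eval_superset:
  assumes "finite S" "Poly_Mapping.keys x \<subseteq> S" "S \<subseteq> good_words E"
  shows "free_eval A m x = (\<Oplus>w\<in>S. Poly_Mapping.lookup x w \<odot> word_eval A m (letters w))"
  unfolding free_eval_def
proof (rule add.finprod_mono_neutral_cong_left[OF assms(1,2)])
  fix w assume "w \<in> S - Poly_Mapping.keys x"
  then show "Poly_Mapping.lookup x w \<odot> word_eval A m (letters w) = \<zero>"
    using assms(3) by (auto simp: in_keys_iff good_words_def intro!: smult_zero_left word_eval_closed)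
qed (use assms(3) in \<open>auto intro!: term_closed\<close>)

lemma free_eval_closed: "x \<in> carrier (Fr E) \<Longrightarrow> free_eval A m x \<in> carrier A"
  unfolding free_eval_def by (intro finsum_closed) (auto simp: Fr_carrier intro!: term_closed)

lemma free_eval_zero: "free_eval A m 0 = \<zero>"
  by (simp add: free_eval_def)

lemma free_eval_add:
  assumes "x \<in> carrier (Fr E)" "y \<in> carrier (Fr E)"
  shows "free_eval A m (x + y) = free_eval A m x \<oplus> free_eval A m y"
proof -
  let ?S = "Poly_Mapping.keys x \<union> Poly_Mapping.keys y"
  have S: "finite ?S" "?S \<subseteq> good_words E"
    using assms by (auto simp: Fr_carrier)
  have "free_eval A m (x + y)
      = (\<Oplus>w\<in>?S. Poly_Mapping.lookup (x + y) w \<odot> word_eval A m (letters w))"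
    by (rule free_eval_superset[OF S(1) keys_add S(2)])
  also have "\<dots> = (\<Oplus>w\<in>?S. Poly_Mapping.lookup x w \<odot> word_eval A m (letters w)
      \<oplus> Poly_Mapping.lookup y w \<odot> word_eval A m (letters w))"
    using S(2) by (intro finsum_cong')
      (auto simp: lookup_add intro!: smult_add_left word_eval_closed add.m_closed term_closed simp: good_words_def)
  also have "\<dots> = free_eval A m x \<oplus> free_eval A m y"
    using S by (subst finsum_addf) (auto intro!: term_closed simp: free_eval_superset[of ?S])
  finally show ?thesis .
qed

lemma free_eval_single:
  "w \<in> good_words E \<Longrightarrow> free_eval A m (Poly_Mapping.single w c) = c \<odot> word_eval A m (letters w)"
  by (subst free_eval_superset[of "{w}"]) (auto simp: term_closed)

lemma free_eval_gen: "g \<in> generators E \<Longrightarrow> free_eval A m (gen g) = m g"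
  by (simp add: gen_def free_eval_single good_words_def smult_one m_closed)

lemma free_eval_scal:
  assumes "x \<in> carrier (Fr E)"
  shows "free_eval A m (scal c x) = c \<odot> free_eval A m x"
  using assms
proof (induction x rule: Fr_induct)
  case (single w d)
  then show ?case
    by (simp only: scal_single free_eval_single) (intro smult_assoc word_eval_closed, auto simp: good_words_def)
qed (simp_all add: free_eval_zero smult_zero_right Rings.distrib_left free_eval_add smult_add_right
    free_eval_closed Fr_scal)

lemma free_eval_mult:
  assumes "x \<in> carrier (Fr E)" "y \<in> carrier (Fr E)"
  shows "free_eval A m (x * y) = free_eval A m x \<otimes> free_eval A m y"
  using assms(1)
proof (induction x rule: Fr_induct)
  case zero
  then show ?case
    using assms by (simp add: free_eval_zero mult_zero_left free_eval_closed)
next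
  case (add x x')
  then show ?case
    using assms by (simp add: Rings.distrib_right free_eval_add distrib_right free_eval_closed Fr_mult)
next
  case (single u c)
  have cl: "free_eval A m (Poly_Mapping.single u c) \<in> carrier A"
    using single by (simp add: free_eval_closed Fr_single)
  show ?case
    using assms(2)
  proof (induction y rule: Fr_induct)
    case zero
    then show ?case using cl by (simp add: free_eval_zero mult_zero_right)
  next
    case (add y y')
    then show ?case
      using cl single
      by (simp add: Rings.distrib_left free_eval_add distrib_left free_eval_closed Fr_mult Fr_single)
  next
    case (single w d)
    note uw = \<open>u \<in> good_words E\<close> \<open>w \<in> good_words E\<close>
    have e: "word_eval A m (letters u) \<in> carrier A" "word_eval A m (letters w) \<in> carrier A"
      using uw by (auto simp: good_words_def intro!: word_eval_closed)
    have "word_eval A m (letters (u + w)) = word_eval A m (letters u) \<otimes> word_eval A m (letters w)"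
      using uw by (simp add: plus_monomial_def good_words_def word_eval_append)
    then show ?case
      using uw e
      by (simp add: mult_single free_eval_single good_add smult_mult_left smult_mult_right closed mult.commute
          flip: smult_assoc)
  qed
qed

lemma free_eval_star:
  assumes "x \<in> carrier (Fr E)"
  shows "free_eval A m (free_star x) = adj A (free_eval A m x)"
  using assms
proof (induction x rule: Fr_induct)
  case (single w c)
  then have "word_eval A m (letters w) \<in> carrier A"
    by (auto simp: good_words_def intro!: word_eval_closed)
  moreover have "word_eval A m (letters (monomial_star w)) = adj A (word_eval A m (letters w))"
    using single by (simp add: monomial_star_def good_words_def word_eval_star)
  ultimately show ?case
    using single by (simp add: free_star_single free_eval_single good_star adj_smult)
qed (simp_all add: free_eval_zero adj_zero free_star_add free_eval_add adj_add free_eval_closed Fr_star)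

lemma free_eval_hom: "star_hom (Fr E) A (free_eval A m)"
  by (simp add: star_hom_def free_eval_closed free_eval_add free_eval_mult free_eval_star free_eval_scal)

lemma free_eval_diff:
  assumes "x \<in> carrier (Fr E)" "y \<in> carrier (Fr E)"
  shows "free_eval A m (x - y) = free_eval A m x \<ominus> free_eval A m y"
proof -
  have "x - y = x + scal (-1) y"
    by (simp add: scal_uminus)
  then show ?thesis
    using assms by (simp only: free_eval_add free_eval_scal Fr_scal minus_eq_smult free_eval_closed)
qed

lemma free_eval_sum:
  "\<lbrakk>finite S; \<And>i. i \<in> S \<Longrightarrow> f i \<in> carrier (Fr E)\<rbrakk>
    \<Longrightarrow> free_eval A m (sum f S) = (\<Oplus>i\<in>S. free_eval A m (f i))"
proof (induction S rule: finite_induct)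
  case (insert i S)
  then show ?case
    by (subst finsum_insert) (auto simp: free_eval_add Fr_sum intro: free_eval_closed)
qed (simp add: free_eval_zero)

end


section \<open>The universal property of graph \<open>C\<^sup>*\<close>-algebras\<close>

context
  fixes E :: "('v, 'e) pre_digraph"
  assumes E: "wf_digraph E"
begin

interpretation wf_digraph E by (rule E)

interpretation F: seminormed_star_algebra "Fr E" "ck_norm E"
  by (rule seminormed_free[OF E])

theorem graph_cstar_algebra: "cstar_algebra (graph_cstar_algebra E)"
  unfolding graph_cstar_algebra_def by (rule F.completion_cstar_algebra)

interpretation H: cstar_algebra "cstar_completion (Fr E) (ck_norm E)"
  by (rule F.completion_cstar_algebra)

lemma vert_carrier: "v \<in> verts E \<Longrightarrow> vert_gen v \<in> carrier (Fr E)"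
  by (auto intro!: Fr_gen simp: generators_def)

lemma edge_carrier: "e \<in> arcs E \<Longrightarrow> edge_gen e \<in> carrier (Fr E)"
  by (auto intro!: Fr_gen simp: generators_def)

lemma ghost_carrier: "e \<in> arcs E \<Longrightarrow> ghost_gen e \<in> carrier (Fr E)"
  by (auto intro!: Fr_gen simp: generators_def)

lemmas gen_carriers = vert_carrier edge_carrier ghost_carrier

lemma \<iota>_simps:
  "x \<in> carrier (Fr E) \<Longrightarrow> y \<in> carrier (Fr E) \<Longrightarrow> F.\<iota> x \<oplus>\<^bsub>F.H\<^esub> F.\<iota> y = F.\<iota> (x + y)"
  "x \<in> carrier (Fr E) \<Longrightarrow> y \<in> carrier (Fr E) \<Longrightarrow> F.\<iota> x \<otimes>\<^bsub>F.H\<^esub> F.\<iota> y = F.\<iota> (x * y)"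
  "x \<in> carrier (Fr E) \<Longrightarrow> adj F.H (F.\<iota> x) = F.\<iota> (free_star x)"
  "x \<in> carrier (Fr E) \<Longrightarrow> c \<odot>\<^bsub>F.H\<^esub> F.\<iota> x = F.\<iota> (scal c x)"
  using F.\<iota>_hom by (simp_all add: star_hom_def)

lemma \<iota>_zero: "F.\<iota> 0 = \<zero>\<^bsub>F.H\<^esub>"
  using F.\<iota>_cls[of 0] F.cls_zero by simp

lemma \<iota>_sum:
  "\<lbrakk>finite S; \<And>i. i \<in> S \<Longrightarrow> f i \<in> carrier (Fr E)\<rbrakk>
    \<Longrightarrow> F.\<iota> (sum f S) = (\<Oplus>\<^bsub>F.H\<^esub>i\<in>S. F.\<iota> (f i))"
proof (induction S rule: finite_induct)
  case (insert i S)
  have "(\<Oplus>\<^bsub>F.H\<^esub>i\<in>insert i S. F.\<iota> (f i)) = F.\<iota> (f i) \<oplus>\<^bsub>F.H\<^esub> (\<Oplus>\<^bsub>F.H\<^esub>i\<in>S. F.\<iota> (f i))"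
    using insert by (intro H.finsum_insert) (auto intro: F.\<iota>_closed)
  also have "\<dots> = F.\<iota> (f i) \<oplus>\<^bsub>F.H\<^esub> F.\<iota> (sum f S)"
    using insert by simp
  also have "\<dots> = F.\<iota> (f i + sum f S)"
    using insert by (intro \<iota>_simps Fr_sum) auto
  finally show ?case
    using insert by simp
qed (simp add: \<iota>_zero)

lemma \<iota>_relator: "x \<in> ck_relators E \<Longrightarrow> F.\<iota> x = \<zero>\<^bsub>F.H\<^esub>"
  by (intro H.norm_definite F.\<iota>_closed) (simp_all add: F.\<iota>_norm ck_norm_relator ck_relators_carrier[OF E])

lemma \<iota>_relator_eq:
  assumes "x - y \<in> ck_relators E" "x \<in> carrier (Fr E)" "y \<in> carrier (Fr E)"
  shows "F.\<iota> x = F.\<iota> y"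
  using \<iota>_relator[OF assms(1)] assms(2,3)
  by - (rule H.diff_eq_zeroD, simp_all add: F.\<iota>_closed F.\<iota>_minus free_minus)

theorem graph_cstar_ck_family: "ck_family E (graph_cstar_algebra E) (graph_proj E) (graph_isom E)"
  unfolding ck_family_def is_projection_def is_partial_isometry_def projection_le_def
    graph_cstar_algebra_def graph_proj_def graph_isom_def
proof (intro conjI ballI allI impI)
  fix v assume v: "v \<in> verts E"
  show "F.\<iota> (vert_gen v) \<in> carrier F.H"
    using v by (simp add: F.\<iota>_closed gen_carriers)
  show "adj F.H (F.\<iota> (vert_gen v)) = F.\<iota> (vert_gen v)"
    using v by (simp add: \<iota>_simps gen_carriers free_star_gen)
  have "vert_gen v * vert_gen v - vert_gen v \<in> ck_relators E"
    unfolding ck_relators_def using v by blast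
  then show "F.\<iota> (vert_gen v) \<otimes>\<^bsub>F.H\<^esub> F.\<iota> (vert_gen v) = F.\<iota> (vert_gen v)"
    using v by (simp add: \<iota>_simps gen_carriers Fr_mult \<iota>_relator_eq)
  fix w assume w: "w \<in> verts E" "v \<noteq> w"
  have "vert_gen v * vert_gen w \<in> ck_relators E"
    unfolding ck_relators_def using v w by blast
  then show "F.\<iota> (vert_gen v) \<otimes>\<^bsub>F.H\<^esub> F.\<iota> (vert_gen w) = \<zero>\<^bsub>F.H\<^esub>"
    using v w by (simp add: \<iota>_simps gen_carriers \<iota>_relator)
next
  fix e assume e: "e \<in> arcs E"
  note c = vert_carrier[OF tail_in_verts[OF e]] vert_carrier[OF head_in_verts[OF e]] gen_carriers(2,3)[OF e]
  show "F.\<iota> (edge_gen e) \<in> carrier F.H"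
    using c by (simp add: F.\<iota>_closed)
  have "edge_gen e * ghost_gen e * edge_gen e - edge_gen e \<in> ck_relators E"
    unfolding ck_relators_def using e by blast
  then show "F.\<iota> (edge_gen e) \<otimes>\<^bsub>F.H\<^esub> adj F.H (F.\<iota> (edge_gen e)) \<otimes>\<^bsub>F.H\<^esub> F.\<iota> (edge_gen e) = F.\<iota> (edge_gen e)"
    using c by (simp add: \<iota>_simps free_star_gen Fr_mult \<iota>_relator_eq)
  have "ghost_gen e * edge_gen e - vert_gen (head E e) \<in> ck_relators E"
    unfolding ck_relators_def using e by blast
  then show "adj F.H (F.\<iota> (edge_gen e)) \<otimes>\<^bsub>F.H\<^esub> F.\<iota> (edge_gen e) = F.\<iota> (vert_gen (head E e))"
    using c by (simp add: \<iota>_simps free_star_gen Fr_mult \<iota>_relator_eq)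
  have "vert_gen (tail E e) * (edge_gen e * ghost_gen e) - edge_gen e * ghost_gen e \<in> ck_relators E"
    unfolding ck_relators_def using e by blast
  then show "F.\<iota> (vert_gen (tail E e)) \<otimes>\<^bsub>F.H\<^esub> (F.\<iota> (edge_gen e) \<otimes>\<^bsub>F.H\<^esub> adj F.H (F.\<iota> (edge_gen e)))
      = F.\<iota> (edge_gen e) \<otimes>\<^bsub>F.H\<^esub> adj F.H (F.\<iota> (edge_gen e))"
    using c by (simp add: \<iota>_simps free_star_gen Fr_mult \<iota>_relator_eq)
  have "edge_gen e * ghost_gen e * vert_gen (tail E e) - edge_gen e * ghost_gen e \<in> ck_relators E"
    unfolding ck_relators_def using e by blast
  then show "F.\<iota> (edge_gen e) \<otimes>\<^bsub>F.H\<^esub> adj F.H (F.\<iota> (edge_gen e)) \<otimes>\<^bsub>F.H\<^esub> F.\<iota> (vert_gen (tail E e))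
      = F.\<iota> (edge_gen e) \<otimes>\<^bsub>F.H\<^esub> adj F.H (F.\<iota> (edge_gen e))"
    using c by (simp add: \<iota>_simps free_star_gen Fr_mult \<iota>_relator_eq)
  fix f assume f: "f \<in> arcs E" "e \<noteq> f"
  have "ghost_gen e * edge_gen f \<in> ck_relators E"
    unfolding ck_relators_def using e f by blast
  then show "adj F.H (F.\<iota> (edge_gen e)) \<otimes>\<^bsub>F.H\<^esub> F.\<iota> (edge_gen f) = \<zero>\<^bsub>F.H\<^esub>"
    using c edge_carrier[OF f(1)]
    by (simp add: \<iota>_simps free_star_gen gen_carriers \<iota>_relator)
next
  fix v assume v: "regular_vertex E v"
  then have fin: "finite (out_arcs E v)" and vE: "v \<in> verts E"
    by (simp_all add: regular_vertex_def)
  have c: "edge_gen e * ghost_gen e \<in> carrier (Fr E)" if "e \<in> out_arcs E v" for e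
    using that by (simp add: gen_carriers Fr_mult)
  have "vert_gen v - (\<Sum>e\<in>out_arcs E v. edge_gen e * ghost_gen e) \<in> ck_relators E"
    unfolding ck_relators_def using v by blast
  then have "F.\<iota> (vert_gen v) = F.\<iota> (\<Sum>e\<in>out_arcs E v. edge_gen e * ghost_gen e)"
    using c vE by (intro \<iota>_relator_eq Fr_sum gen_carriers)
  also have "\<dots> = (\<Oplus>\<^bsub>F.H\<^esub>e\<in>out_arcs E v. F.\<iota> (edge_gen e * ghost_gen e))"
    by (rule \<iota>_sum[OF fin c])
  also have "\<dots> = (\<Oplus>\<^bsub>F.H\<^esub>e\<in>out_arcs E v. F.\<iota> (edge_gen e) \<otimes>\<^bsub>F.H\<^esub> adj F.H (F.\<iota> (edge_gen e)))"
    by (rule H.finsum_cong')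
      (auto simp: \<iota>_simps gen_carriers free_star_gen Fr_mult intro!: F.\<iota>_closed)
  finally show "F.\<iota> (vert_gen v)
      = (\<Oplus>\<^bsub>F.H\<^esub>e\<in>out_arcs E v. F.\<iota> (edge_gen e) \<otimes>\<^bsub>F.H\<^esub> adj F.H (F.\<iota> (edge_gen e)))" .
qed

text \<open>The canonical family generates: a closed \<open>*\<close>-subalgebra containing it is everything.\<close>

theorem graph_cstar_generated:
  defines "G \<equiv> graph_cstar_algebra E"
  assumes S: "S \<subseteq> carrier G" "\<zero>\<^bsub>G\<^esub> \<in> S"
    and S_add: "\<And>x y. \<lbrakk>x \<in> S; y \<in> S\<rbrakk> \<Longrightarrow> x \<oplus>\<^bsub>G\<^esub> y \<in> S"
    and S_smult: "\<And>c x. x \<in> S \<Longrightarrow> c \<odot>\<^bsub>G\<^esub> x \<in> S"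
    and S_mult: "\<And>x y. \<lbrakk>x \<in> S; y \<in> S\<rbrakk> \<Longrightarrow> x \<otimes>\<^bsub>G\<^esub> y \<in> S"
    and S_adj: "\<And>x. x \<in> S \<Longrightarrow> adj G x \<in> S"
    and S_limit: "\<And>X l. \<lbrakk>\<And>n. X n \<in> S; l \<in> carrier G; converges_in G (alg_norm G) X l\<rbrakk> \<Longrightarrow> l \<in> S"
    and S_proj: "\<And>v. v \<in> verts E \<Longrightarrow> graph_proj E v \<in> S"
    and S_isom: "\<And>e. e \<in> arcs E \<Longrightarrow> graph_isom E e \<in> S"
  shows "S = carrier G"
proof (intro equalityI S(1) subsetI)
  have G: "G = F.H"
    by (simp add: G_def graph_cstar_algebra_def)
  have gens: "F.\<iota> (gen g) \<in> S" if "g \<in> generators E" for g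
  proof (cases g)
    case (Ghost e)
    then have "F.\<iota> (gen g) = adj G (graph_isom E e)"
      using that by (simp add: graph_isom_def G \<iota>_simps Fr_gen generators_def free_star_gen image_iff)
    then show ?thesis
      using Ghost that S_adj S_isom by (auto simp: generators_def)
  qed (use that S_proj S_isom in \<open>auto simp: generators_def graph_proj_def graph_isom_def\<close>)
  have words: "F.\<iota> (Poly_Mapping.single (Monomial ws) 1) \<in> S"
    if "ws \<noteq> []" "set ws \<subseteq> generators E" for ws
    using that
  proof (induction ws rule: list_nonempty_induct)
    case (single g)
    then show ?case using gens[of g] by (simp add: gen_def)
  next
    case (cons g ws)
    have "Poly_Mapping.single (Monomial (g # ws)) 1 = gen g * Poly_Mapping.single (Monomial ws) 1"
      by (simp add: gen_def mult_single plus_monomial_def)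
    moreover have "gen g \<in> carrier (Fr E)" "Poly_Mapping.single (Monomial ws) 1 \<in> carrier (Fr E)"
      using cons by (auto intro!: Fr_gen Fr_single simp: good_words_def)
    ultimately show ?case
      using S_mult[OF gens[of g] cons.IH] cons by (simp add: G \<iota>_simps)
  qed
  have alg: "F.\<iota> x \<in> S" if "x \<in> carrier (Fr E)" for x
    using that
  proof (induction x rule: Fr_induct)
    case zero
    then show ?case using S(2) by (simp add: G \<iota>_zero)
  next
    case (single w c)
    then have "F.\<iota> (Poly_Mapping.single w 1) \<in> S"
      using words[of "letters w"] by (simp add: good_words_def)
    then show ?case
      using S_smult[of "F.\<iota> (Poly_Mapping.single w 1)" c] single
      by (simp add: G \<iota>_simps Fr_single mult_single)
  next
    case (add x y)
    then show ?case using S_add[of "F.\<iota> x" "F.\<iota> y"] by (simp add: G \<iota>_simps)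
  qed
  fix x assume "x \<in> carrier G"
  then obtain X where X: "F.cauchy X" "x = F.cls X"
    unfolding G by (rule F.H_cases)
  show "x \<in> S"
  proof (rule S_limit)
    show "F.\<iota> (X n) \<in> S" for n
      using X by (intro alg F.cauchy_closed)
    show "converges_in G (alg_norm G) (\<lambda>n. F.\<iota> (X n)) x"
      unfolding X G by (rule F.\<iota>_converges[OF X(1)])
  qed fact
qed

text \<open>
  Cuntz--Krieger families in \<open>C\<^sup>*\<close>-algebras \<open>B\<close>, with elements of any type, extend to
  \<open>*\<close>-homomorphisms.
\<close>

theorem graph_cstar_universal:
  assumes B: "cstar_algebra B" and ck: "ck_family E B p s"
  shows "\<exists>\<Phi>. star_hom (graph_cstar_algebra E) B \<Phi> \<and>
    (\<forall>v\<in>verts E. \<Phi> (graph_proj E v) = p v) \<and> (\<forall>e\<in>arcs E. \<Phi> (graph_isom E e) = s e)"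
proof -
  interpret B: cstar_algebra B by (rule B)
  define m where "m g = (case g of Vertex v \<Rightarrow> p v | Edge e \<Rightarrow> s e | Ghost e \<Rightarrow> adj B (s e))" for g
  have m_simps [simp]: "m (Vertex v) = p v" "m (Edge e) = s e" "m (Ghost e) = adj B (s e)" for v e
    by (simp_all add: m_def)
  have p: "p v \<in> carrier B" "adj B (p v) = p v" "p v \<otimes>\<^bsub>B\<^esub> p v = p v" if "v \<in> verts E" for v
    using ck that by (simp_all add: ck_family_def is_projection_def)
  have s: "s e \<in> carrier B" if "e \<in> arcs E" for e
    using ck that by (simp add: ck_family_def is_partial_isometry_def)
  interpret generator_assignment B E m
    by unfold_locales (auto simp: generators_def p s B.adj_closed B.adj_adj)
  define q where "q x = alg_norm B (free_eval B m x)" for x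
  have "cstar_seminorm (Fr E) q"
    using B.seminorm
    by (simp add: cstar_seminorm_def q_def free_eval_add free_eval_mult free_eval_scal free_eval_star
        free_eval_closed Fr_closed)
  moreover have "q x = 0" if x: "x \<in> ck_relators E" for x
  proof -
    have pe: "free_eval B m (vert_gen v) = p v" if "v \<in> verts E" for v
      using that by (simp add: free_eval_gen generators_def)
    have se: "free_eval B m (edge_gen e) = s e" "free_eval B m (ghost_gen e) = adj B (s e)"
      if "e \<in> arcs E" for e
      using that by (simp_all add: free_eval_gen generators_def)
    have reg: "free_eval B m (\<Sum>e\<in>out_arcs E v. edge_gen e * ghost_gen e) = p v"
      if v: "regular_vertex E v" for v
    proof -
      have fin: "finite (out_arcs E v)"
        using v by (simp add: regular_vertex_def)
      have "free_eval B m (\<Sum>e\<in>out_arcs E v. edge_gen e * ghost_gen e)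
          = (\<Oplus>\<^bsub>B\<^esub>e\<in>out_arcs E v. free_eval B m (edge_gen e * ghost_gen e))"
        by (rule free_eval_sum[OF fin]) (simp add: gen_carriers Fr_mult)
      also have "\<dots> = (\<Oplus>\<^bsub>B\<^esub>e\<in>out_arcs E v. s e \<otimes>\<^bsub>B\<^esub> adj B (s e))"
        by (rule B.finsum_cong')
          (auto simp: free_eval_mult gen_carriers se s B.closed)
      also have "\<dots> = p v"
        using ck v by (simp add: ck_family_def)
      finally show ?thesis .
    qed
    have sumc: "(\<Sum>e\<in>out_arcs E v. edge_gen e * ghost_gen e) \<in> carrier (Fr E)" for v
      by (rule Fr_sum) (simp add: gen_carriers Fr_mult)
    have "free_eval B m x = \<zero>\<^bsub>B\<^esub>"
      using x ck unfolding ck_relators_def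
      by (elim UnE CollectE exE conjE)
        (simp_all add: free_eval_diff free_eval_mult pe se reg gen_carriers Fr_mult sumc
          regular_vertex_def ck_family_def is_projection_def is_partial_isometry_def projection_le_def
          B.diff_self B.closed p s)
    then show ?thesis
      by (simp add: q_def B.N_zero)
  qed
  ultimately have qck: "q \<in> ck_seminorms E"
    by (simp add: ck_seminorms_def)
  have "alg_norm B (free_eval B m x) \<le> ck_norm E x" if "x \<in> carrier (Fr E)" for x
    using ck_norm_upper[OF E that qck] by (simp add: q_def)
  from F.completion_extend[OF B free_eval_hom this]
  obtain \<Phi> where \<Phi>: "star_hom F.H B \<Phi>" "\<And>x. x \<in> carrier (Fr E) \<Longrightarrow> \<Phi> (F.\<iota> x) = free_eval B m x"
    by blast
  have "\<Phi> (graph_proj E v) = p v" if "v \<in> verts E" for v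
    using that by (simp add: graph_proj_def \<Phi>(2) gen_carriers free_eval_gen generators_def)
  moreover have "\<Phi> (graph_isom E e) = s e" if "e \<in> arcs E" for e
    using that by (simp add: graph_isom_def \<Phi>(2) gen_carriers free_eval_gen generators_def)
  ultimately show ?thesis
    using \<Phi>(1) unfolding graph_cstar_algebra_def by blast
qed

end

end

theory Submission
  imports Defs
begin

text \<open>
  The relators of a Cuntz--Krieger family and those of the Leavitt path algebra vanish under
  the same \<open>C\<^sup>*\<close>-seminorms on the free \<open>*\<close>-algebra.  Hence \<open>C\<^sup>*(E)\<close> is the completion of
  \<open>L(E)\<close> in the supremum of all its \<open>C\<^sup>*\<close>-seminorms, and this norm depends only on the
  \<open>*\<close>-algebra structure of \<open>L(E)\<close>.
\<close>

section \<open>\<open>*\<close>-isomorphisms and completions\<close>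

lemma star_hom_comp: "\<lbrakk>star_hom A B \<phi>; star_hom B C \<psi>\<rbrakk> \<Longrightarrow> star_hom A C (\<lambda>x. \<psi> (\<phi> x))"
  by (simp add: star_hom_def)

lemma star_isomorphic_trans:
  assumes "star_isomorphic A B" "star_isomorphic B C"
  shows "star_isomorphic A C"
proof -
  obtain \<phi> \<psi> where "star_hom A B \<phi>" "bij_betw \<phi> (carrier A) (carrier B)"
    "star_hom B C \<psi>" "bij_betw \<psi> (carrier B) (carrier C)"
    using assms by (auto simp: star_isomorphic_def)
  then show ?thesis
    unfolding star_isomorphic_def using star_hom_comp bij_betw_trans[unfolded comp_def] by blast
qed

text \<open>On images under \<open>\<phi>\<close>, the operations of \<open>B\<close> are
  \<open>\<phi>\<close> of operations in \<open>A\<close>. Closure of \<open>A\<close> puts the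
  results back in its carrier, where the inverse cancels \<open>\<phi>\<close>.\<close>

lemma star_isomorphic_sym:
  assumes A: "star_algebra A" and iso: "star_isomorphic A B"
  shows "star_isomorphic B A"
proof -
  interpret A: star_algebra A by (rule A)
  obtain \<phi> where \<phi>: "star_hom A B \<phi>" and bij: "bij_betw \<phi> (carrier A) (carrier B)"
    using iso by (auto simp: star_isomorphic_def)
  define \<psi> where "\<psi> = inv_into (carrier A) \<phi>"
  have \<psi>\<phi>: "\<psi> (\<phi> x) = x" if "x \<in> carrier A" for x
    using bij_betw_inv_into_left[OF bij that] by (simp add: \<psi>_def)
  have cases: "\<exists>x\<in>carrier A. y = \<phi> x" if "y \<in> carrier B" for y
    using bij that by (auto simp: bij_betw_def)
  have ops: "\<phi> x \<oplus>\<^bsub>B\<^esub> \<phi> y = \<phi> (x \<oplus>\<^bsub>A\<^esub> y)" "\<phi> x \<otimes>\<^bsub>B\<^esub> \<phi> y = \<phi> (x \<otimes>\<^bsub>A\<^esub> y)"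
    "c \<odot>\<^bsub>B\<^esub> \<phi> x = \<phi> (c \<odot>\<^bsub>A\<^esub> x)" "adj B (\<phi> x) = \<phi> (adj A x)"
    if "x \<in> carrier A" "y \<in> carrier A" for x y c
    using \<phi> that by (simp_all add: star_hom_def)
  have "star_hom B A \<psi>"
    unfolding star_hom_def
    by (auto dest!: cases simp: ops \<psi>\<phi> A.closed)
  moreover have "bij_betw \<psi> (carrier B) (carrier A)"
    unfolding \<psi>_def by (rule bij_betw_inv_into[OF bij])
  ultimately show ?thesis
    by (auto simp: star_isomorphic_def)
qed

lemma star_hom_minus:
  assumes "star_algebra A" "star_algebra B" "star_hom A B \<phi>" "x \<in> carrier A" "y \<in> carrier A"
  shows "\<phi> (x \<ominus>\<^bsub>A\<^esub> y) = \<phi> x \<ominus>\<^bsub>B\<^esub> \<phi> y"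
  using assms by (simp add: star_algebra.minus_eq_smult star_algebra.closed star_hom_def)

text \<open>The map \<open>\<phi>\<close> may have a kernel: isometry forces \<open>N\<close> to
  vanish there, and the Hausdorff completion identifies such elements with zero. This lets a
  quotient map of the free algebra induce an isomorphism.\<close>

lemma completion_isomorphic:
  assumes A: "seminormed_star_algebra A N" and B: "seminormed_star_algebra B M"
    and \<phi>: "star_hom A B \<phi>" and surj: "\<phi> ` carrier A = carrier B"
    and isometric: "\<And>x. x \<in> carrier A \<Longrightarrow> M (\<phi> x) = N x"
  shows "star_isomorphic (cstar_completion A N) (cstar_completion B M)"
proof -
  interpret A: seminormed_star_algebra A N by (rule A)
  interpret B: seminormed_star_algebra B M by (rule B)
  have closed: "\<phi> x \<in> carrier B" if "x \<in> carrier A" for x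
    using \<phi> that by (simp add: star_hom_def)
  have ops2: "\<phi> (x \<oplus>\<^bsub>A\<^esub> y) = \<phi> x \<oplus>\<^bsub>B\<^esub> \<phi> y" "\<phi> (x \<otimes>\<^bsub>A\<^esub> y) = \<phi> x \<otimes>\<^bsub>B\<^esub> \<phi> y"
    if "x \<in> carrier A" "y \<in> carrier A" for x y
    using \<phi> that by (simp_all add: star_hom_def)
  have ops1: "\<phi> (c \<odot>\<^bsub>A\<^esub> x) = c \<odot>\<^bsub>B\<^esub> \<phi> x" "\<phi> (adj A x) = adj B (\<phi> x)"
    if "x \<in> carrier A" for x c
    using \<phi> that by (simp_all add: star_hom_def)
  have dist: "M (\<phi> x \<ominus>\<^bsub>B\<^esub> \<phi> y) = N (x \<ominus>\<^bsub>A\<^esub> y)" if "x \<in> carrier A" "y \<in> carrier A" for x y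
    using star_hom_minus[OF A.star_algebra_axioms B.star_algebra_axioms \<phi> that]
      isometric[of "x \<ominus>\<^bsub>A\<^esub> y"] that by simp
  have cauchy: "B.cauchy (\<lambda>n. \<phi> (X n)) \<longleftrightarrow> A.cauchy X" if "\<And>n. X n \<in> carrier A" for X
    using that by (simp add: cauchy_in_def closed dist)
  have cauchyD: "B.cauchy (\<lambda>n. \<phi> (X n))" if "A.cauchy X" for X
    using cauchy[of X] that by (simp add: A.cauchy_closed)
  \<comment> \<open>From right to left this makes the induced map on classes well defined; from left
    to right it makes that map injective.\<close>
  have cls_eq: "B.cls (\<lambda>n. \<phi> (X n)) = B.cls (\<lambda>n. \<phi> (Y n)) \<longleftrightarrow> A.cls X = A.cls Y"
    if "A.cauchy X" "A.cauchy Y" for X Y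
    using that cauchyD
      eq_equiv_class_iff[OF star_congruence.eqv[OF A.R_congruence], of X Y]
      eq_equiv_class_iff[OF star_congruence.eqv[OF B.R_congruence], of "\<lambda>n. \<phi> (X n)" "\<lambda>n. \<phi> (Y n)"]
    by (simp add: null_rel_def dist A.cauchy_closed)
  define \<Phi> where "\<Phi> \<X> = B.cls (\<lambda>n. \<phi> ((SOME X. A.cauchy X \<and> \<X> = A.cls X) n))" for \<X>
  have \<Phi>: "\<Phi> (A.cls X) = B.cls (\<lambda>n. \<phi> (X n))" if "A.cauchy X" for X
  proof -
    let ?Y = "SOME Y. A.cauchy Y \<and> A.cls X = A.cls Y"
    have "A.cauchy ?Y \<and> A.cls X = A.cls ?Y"
      by (rule someI[where x = X]) (use that in simp)
    then show ?thesis
      using cls_eq[of ?Y X] that by (simp add: \<Phi>_def)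
  qed
  have cases: "\<exists>X. A.cauchy X \<and> \<X> = A.cls X" if "\<X> \<in> carrier A.H" for \<X>
    using that by (blast elim: A.H_cases)
  have "star_hom A.H B.H \<Phi>"
    unfolding star_hom_def
    by (auto dest!: cases simp: \<Phi> A.cls_add A.cls_mult A.cls_smult A.cls_adj
        B.cls_add B.cls_mult B.cls_smult B.cls_adj B.cls_closed cauchyD
        A.cauchy_add A.cauchy_mult A.cauchy_smult A.cauchy_adj ops2 ops1 A.cauchy_closed)
  moreover have "inj_on \<Phi> (carrier A.H)"
    by (auto intro!: inj_onI dest!: cases simp: \<Phi> cls_eq)
  moreover have "\<Phi> ` carrier A.H = carrier B.H"
  proof (intro equalityI subsetI)
    fix \<Y> assume "\<Y> \<in> carrier B.H"
    then obtain Y where Y: "B.cauchy Y" "\<Y> = B.cls Y" by (rule B.H_cases)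
    \<comment> \<open>Any termwise choice of preimages works: \<open>\<phi>\<close> preserves
      distances, so the lifted sequence is again Cauchy.\<close>
    then have "\<forall>n. \<exists>x\<in>carrier A. Y n = \<phi> x"
      using surj B.cauchy_closed by (metis imageE)
    then obtain X where X: "\<And>n. X n \<in> carrier A" and YX: "Y = (\<lambda>n. \<phi> (X n))"
      by metis
    then have "A.cauchy X"
      using cauchy Y by simp
    then show "\<Y> \<in> \<Phi> ` carrier A.H"
      using \<Phi> A.cls_closed Y YX by (metis image_eqI)
  qed (auto dest!: cases simp: \<Phi> B.cls_closed cauchyD)
  ultimately show ?thesis
    unfolding star_isomorphic_def bij_betw_def by blast
qed

section \<open>The largest \<open>C\<^sup>*\<close>-seminorm\<close>

text \<open>Unspecified at elements on which the \<open>C\<^sup>*\<close>-seminorms are unbounded.\<close>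

definition universal_norm :: "('a, 'm) star_algebra_scheme \<Rightarrow> 'a \<Rightarrow> real" where
  "universal_norm A x = (SUP q\<in>{q. cstar_seminorm A q}. q x)"

lemma cstar_seminorm_comp:
  "\<lbrakk>star_algebra A; star_hom A B \<phi>; cstar_seminorm B q\<rbrakk>
    \<Longrightarrow> cstar_seminorm A (\<lambda>x. q (\<phi> x))"
  by (simp add: star_hom_def cstar_seminorm_def star_algebra.adj_closed)

text \<open>Surjectivity lets each axiom for \<open>q'\<close> be checked on preimages. This serves
  both to push a single seminorm down a quotient and to show that a supremum of seminorms is
  one.\<close>

lemma cstar_seminorm_surj:
  assumes A: "star_algebra A" and \<phi>: "star_hom A B \<phi>" and surj: "\<phi> ` carrier A = carrier B"
    and q: "cstar_seminorm A q" and q': "\<And>x. x \<in> carrier A \<Longrightarrow> q' (\<phi> x) = q x"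
  shows "cstar_seminorm B q'"
proof -
  interpret A: star_algebra A by (rule A)
  have ops: "\<phi> x \<oplus>\<^bsub>B\<^esub> \<phi> y = \<phi> (x \<oplus>\<^bsub>A\<^esub> y)" "\<phi> x \<otimes>\<^bsub>B\<^esub> \<phi> y = \<phi> (x \<otimes>\<^bsub>A\<^esub> y)"
    "c \<odot>\<^bsub>B\<^esub> \<phi> x = \<phi> (c \<odot>\<^bsub>A\<^esub> x)" "adj B (\<phi> x) = \<phi> (adj A x)"
    if "x \<in> carrier A" "y \<in> carrier A" for x y c
    using \<phi> that by (simp_all add: star_hom_def)
  show ?thesis
    using q unfolding cstar_seminorm_def surj[symmetric]
    by (auto simp: ops q' A.closed)
qed

section \<open>Cuntz--Krieger relations and the Leavitt ideal\<close>

context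
  fixes E :: "('v, 'e) pre_digraph"
  assumes E: "wf_digraph E"
begin

interpretation wf_digraph E by (rule E)

text \<open>Apart from three families, these relators are Leavitt relators verbatim. The exceptions,
  the partial isometry relation and the two halves of the order relation on range projections,
  follow algebraically.\<close>

lemma ck_relators_leavitt_ideal:
  assumes "x \<in> ck_relators E"
  shows "x \<in> leavitt_ideal E"
proof -
  note c = vert_carrier[OF E] edge_carrier[OF E] ghost_carrier[OF E]
  have unit: "edge_gen e * ghost_gen e * edge_gen e - edge_gen e \<in> leavitt_ideal E"
    if "e \<in> arcs E" for e
  proof -
    have "ghost_gen e * edge_gen e - vert_gen (head E e) \<in> leavitt_relators E"
      "edge_gen e * vert_gen (head E e) - edge_gen e \<in> leavitt_relators E"
      unfolding leavitt_relators_def using that by blast+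
    \<comment> \<open>The two terms in \<open>edge_gen e * vert_gen (head E e)\<close>
      cancel.\<close>
    then have "edge_gen e * (ghost_gen e * edge_gen e - vert_gen (head E e))
        + (edge_gen e * vert_gen (head E e) - edge_gen e) \<in> leavitt_ideal E"
      using that by (intro leavitt_ideal.add leavitt_ideal.mult_left leavitt_ideal.relator c)
    then show ?thesis
      by (simp add: algebra_simps)
  qed
  have left: "vert_gen (tail E e) * (edge_gen e * ghost_gen e) - edge_gen e * ghost_gen e \<in> leavitt_ideal E"
    if "e \<in> arcs E" for e
  proof -
    have "vert_gen (tail E e) * edge_gen e - edge_gen e \<in> leavitt_relators E"
      unfolding leavitt_relators_def using that by blast
    then have "(vert_gen (tail E e) * edge_gen e - edge_gen e) * ghost_gen e \<in> leavitt_ideal E"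
      using that by (intro leavitt_ideal.mult_right leavitt_ideal.relator c)
    then show ?thesis
      by (simp add: algebra_simps)
  qed
  have right: "edge_gen e * ghost_gen e * vert_gen (tail E e) - edge_gen e * ghost_gen e \<in> leavitt_ideal E"
    if "e \<in> arcs E" for e
    using leavitt_ideal_star[OF left[OF that]]
    by (simp add: free_star_diff free_star_mult free_star_gen)
  have "x \<in> leavitt_relators E \<or>
      (\<exists>e\<in>arcs E. x = edge_gen e * ghost_gen e * edge_gen e - edge_gen e
        \<or> x = vert_gen (tail E e) * (edge_gen e * ghost_gen e) - edge_gen e * ghost_gen e
        \<or> x = edge_gen e * ghost_gen e * vert_gen (tail E e) - edge_gen e * ghost_gen e)"
    using assms unfolding ck_relators_def leavitt_relators_def by blast
  then show ?thesis
    using unit left right leavitt_ideal.relator by blast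
qed

lemma leavitt_relators_carrier: "x \<in> leavitt_relators E \<Longrightarrow> x \<in> carrier (Fr E)"
  unfolding leavitt_relators_def
  by (auto simp: regular_vertex_def intro!: Fr_mult Fr_diff Fr_sum
      vert_carrier[OF E] edge_carrier[OF E] ghost_carrier[OF E])

lemma leavitt_ideal_carrier: "x \<in> leavitt_ideal E \<Longrightarrow> x \<in> carrier (Fr E)"
  by (induction rule: leavitt_ideal.induct)
    (simp_all add: Fr_closed leavitt_relators_carrier)

text \<open>The null space of a C*-seminorm is a two-sided ideal closed under the involution, so
  only the Leavitt relators need checking. The vertex-edge relations come from the Cuntz--Krieger
  ones by algebra, and the ghost relations are their adjoints.\<close>

lemma ck_seminorm_leavitt_ideal:
  assumes q: "q \<in> ck_seminorms E" and x: "x \<in> leavitt_ideal E"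
  shows "q x = 0"
proof -
  interpret seminormed_star_algebra "Fr E" q
    using q by (simp add: seminormed_star_algebra_def seminormed_star_algebra_axioms_def
        free_star_algebra ck_seminorms_def)
  define Z where "Z = {x \<in> carrier (Fr E). q x = 0}"
  note c = vert_carrier[OF E] edge_carrier[OF E] ghost_carrier[OF E]
  have zero: "x \<in> Z" if "x \<in> carrier (Fr E)" "q x \<le> 0" for x
    using that N_nonneg[of x] by (simp add: Z_def)
  have add: "x + y \<in> Z" if "x \<in> Z" "y \<in> Z" for x y
    using that N_add[of x y] by (intro zero) (auto simp: Z_def Fr_add)
  have scal: "scal c x \<in> Z" if "x \<in> Z" for x c
    using that N_smult[of x c] by (simp add: Z_def Fr_scal)
  have left: "a * x \<in> Z" if "x \<in> Z" "a \<in> carrier (Fr E)" for x a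
    using that N_mult[of a x] by (intro zero) (auto simp: Z_def Fr_mult)
  have right: "x * a \<in> Z" if "x \<in> Z" "a \<in> carrier (Fr E)" for x a
    using that N_mult[of x a] by (intro zero) (auto simp: Z_def Fr_mult)
  have star: "free_star x \<in> Z" if "x \<in> Z" for x
    using that N_adj[of x] by (simp add: Z_def Fr_star)
  have diff: "x - y \<in> Z" if "x \<in> Z" "y \<in> Z" for x y
    using add[OF that(1) scal[OF that(2), of "-1"]] by (simp add: scal_uminus)
  have ck: "x \<in> Z" if "x \<in> ck_relators E" for x
    using that q by (simp add: Z_def ck_seminorms_def ck_relators_carrier[OF E])
  have edge: "edge_gen e * ghost_gen e * edge_gen e - edge_gen e \<in> Z"
    "ghost_gen e * edge_gen e - vert_gen (head E e) \<in> Z"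
    "vert_gen (tail E e) * (edge_gen e * ghost_gen e) - edge_gen e * ghost_gen e \<in> Z"
    if "e \<in> arcs E" for e
    using that by (auto intro!: ck simp: ck_relators_def)
  have tail: "vert_gen (tail E e) * edge_gen e - edge_gen e \<in> Z" if e: "e \<in> arcs E" for e
  proof -
    let ?u = "edge_gen e * ghost_gen e * edge_gen e - edge_gen e"
    \<comment> \<open>Multiplying the range projection relation by \<open>edge_gen e\<close> gives
      the wanted relation with \<open>edge_gen e * ghost_gen e * edge_gen e\<close> in place of
      \<open>edge_gen e\<close>; the terms in \<open>?u\<close> correct this.\<close>
    have "(vert_gen (tail E e) * (edge_gen e * ghost_gen e) - edge_gen e * ghost_gen e) * edge_gen e
        - vert_gen (tail E e) * ?u + ?u \<in> Z"
      using e by (intro add diff left right edge c tail_in_verts)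
    then show ?thesis
      by (simp add: algebra_simps)
  qed
  have head: "edge_gen e * vert_gen (head E e) - edge_gen e \<in> Z" if e: "e \<in> arcs E" for e
  proof -
    have "(edge_gen e * ghost_gen e * edge_gen e - edge_gen e)
        - edge_gen e * (ghost_gen e * edge_gen e - vert_gen (head E e)) \<in> Z"
      using e by (intro diff left edge c)
    then show ?thesis
      by (simp add: algebra_simps)
  qed
  have ghost: "vert_gen (head E e) * ghost_gen e - ghost_gen e \<in> Z"
    "ghost_gen e * vert_gen (tail E e) - ghost_gen e \<in> Z" if "e \<in> arcs E" for e
    using star[OF head[OF that]] star[OF tail[OF that]]
    by (simp_all add: free_star_diff free_star_mult free_star_gen)
  have relators: "y \<in> Z" if "y \<in> leavitt_relators E" for y
  proof -
    have "y \<in> ck_relators E \<or>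
        (\<exists>e\<in>arcs E. y = vert_gen (tail E e) * edge_gen e - edge_gen e
          \<or> y = edge_gen e * vert_gen (head E e) - edge_gen e
          \<or> y = vert_gen (head E e) * ghost_gen e - ghost_gen e
          \<or> y = ghost_gen e * vert_gen (tail E e) - ghost_gen e)"
      using that unfolding ck_relators_def leavitt_relators_def by blast
    then show ?thesis
      using ck tail head ghost by blast
  qed
  from x have "x \<in> Z"
  proof (induction rule: leavitt_ideal.induct)
    case zero
    show ?case using N_zero by (simp add: Z_def Fr_zero)
  qed (simp_all add: relators add scal left right)
  then show ?thesis
    by (simp add: Z_def)
qed

text \<open>Composition with \<open>\<rho>\<close> matches all C*-seminorms on \<open>B\<close> with
  those in \<open>ck_seminorms E\<close>, so the suprema agree and \<open>\<rho>\<close> is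
  isometric. With \<open>B\<close> left general, one algebra can serve as target for two different
  graphs.\<close>

lemma graph_cstar_isomorphic_completion:
  assumes B: "star_algebra B" and \<rho>: "star_hom (Fr E) B \<rho>"
    and surj: "\<rho> ` carrier (Fr E) = carrier B"
    and kernel: "\<And>x y. \<lbrakk>x \<in> carrier (Fr E); y \<in> carrier (Fr E)\<rbrakk>
      \<Longrightarrow> \<rho> x = \<rho> y \<longleftrightarrow> x - y \<in> leavitt_ideal E"
  shows "star_isomorphic (graph_cstar_algebra E) (cstar_completion B (universal_norm B))"
proof -
  interpret B: star_algebra B by (rule B)
  have push: "\<exists>q'. cstar_seminorm B q' \<and> (\<forall>x\<in>carrier (Fr E). q' (\<rho> x) = q x)"
    if q: "q \<in> ck_seminorms E" for q
  proof -
    have sq: "cstar_seminorm (Fr E) q"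
      using q by (simp add: ck_seminorms_def)
    interpret seminormed_star_algebra "Fr E" q
      using sq by (simp add: seminormed_star_algebra_def seminormed_star_algebra_axioms_def
          free_star_algebra)
    \<comment> \<open>The choice of preimage is harmless: two preimages differ by an element of the
      Leavitt ideal, on which \<open>q\<close> vanishes.\<close>
    define q' where "q' y = q (inv_into (carrier (Fr E)) \<rho> y)" for y
    have "q' (\<rho> x) = q x" if x: "x \<in> carrier (Fr E)" for x
    proof -
      let ?z = "inv_into (carrier (Fr E)) \<rho> (\<rho> x)"
      have z: "?z \<in> carrier (Fr E)" "\<rho> ?z = \<rho> x"
        using x by (auto intro: inv_into_into f_inv_into_f)
      then have "q (?z - x) = 0"
        using x q kernel[OF z(1) x] by (intro ck_seminorm_leavitt_ideal) auto
      then show ?thesis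
        using N_abs_diff[OF z(1) x] z x by (simp add: q'_def free_minus)
    qed
    then show ?thesis
      using cstar_seminorm_surj[OF free_star_algebra \<rho> surj sq] by blast
  qed
  have pull: "(\<lambda>x. q (\<rho> x)) \<in> ck_seminorms E" if q: "cstar_seminorm B q" for q
  proof -
    interpret Q: seminormed_star_algebra B q
      using q B by (simp add: seminormed_star_algebra_def seminormed_star_algebra_axioms_def)
    have "\<rho> 0 = \<zero>\<^bsub>B\<^esub>"
    proof -
      have "\<rho> (0 \<odot>\<^bsub>Fr E\<^esub> 0) = 0 \<odot>\<^bsub>B\<^esub> \<rho> 0" "\<rho> 0 \<in> carrier B"
        using \<rho> Fr_zero[of E] unfolding star_hom_def by blast+
      then show ?thesis by (simp add: B.smult_zero_left)
    qed
    \<comment> \<open>The kernel condition is used with \<open>y = 0\<close>, since Cuntz--Krieger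
      relators lie in the Leavitt ideal.\<close>
    then have "\<rho> x = \<zero>\<^bsub>B\<^esub>" if "x \<in> ck_relators E" for x
      using that kernel[of x 0] ck_relators_leavitt_ideal ck_relators_carrier[OF E] Fr_zero
      by fastforce
    then show ?thesis
      using cstar_seminorm_comp[OF free_star_algebra \<rho> q] Q.N_zero by (simp add: ck_seminorms_def)
  qed
  have norm: "universal_norm B (\<rho> x) = ck_norm E x" if x: "x \<in> carrier (Fr E)" for x
  proof -
    have "(\<lambda>q. q (\<rho> x)) ` {q. cstar_seminorm B q} = (\<lambda>q. q x) ` ck_seminorms E"
    proof (intro equalityI subsetI)
      fix r assume "r \<in> (\<lambda>q. q (\<rho> x)) ` {q. cstar_seminorm B q}"
      then show "r \<in> (\<lambda>q. q x) ` ck_seminorms E"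
        using pull by (auto intro!: rev_image_eqI)
    next
      fix r assume "r \<in> (\<lambda>q. q x) ` ck_seminorms E"
      then obtain q q' where "q \<in> ck_seminorms E" "r = q x" "cstar_seminorm B q'" "q' (\<rho> x) = q x"
        using push x by blast
      then show "r \<in> (\<lambda>q. q (\<rho> x)) ` {q. cstar_seminorm B q}"
        by (auto intro!: rev_image_eqI)
    qed
    then show ?thesis
      by (simp add: universal_norm_def ck_norm_def)
  qed
  \<comment> \<open>A supremum of all C*-seminorms need not be finite on an arbitrary algebra. Here
    it inherits the seminorm axioms from \<open>ck_norm E\<close>, with which it agrees along
    \<open>\<rho>\<close>.\<close>
  have seminormed: "seminormed_star_algebra B (universal_norm B)"
    using cstar_seminorm_surj[OF free_star_algebra \<rho> surj ck_norm_seminorm[OF E] norm] B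
    by (simp add: seminormed_star_algebra_def seminormed_star_algebra_axioms_def)
  show ?thesis
    unfolding graph_cstar_algebra_def
    by (rule completion_isomorphic[OF seminormed_free[OF E] seminormed \<rho> surj norm])
qed

end

section \<open>Comparison of two graphs through one Leavitt path algebra\<close>

lemma leavitt_quotient:
  fixes E :: "('v, 'e) pre_digraph"
  defines "\<pi> \<equiv> \<lambda>x. leavitt_rel E `` {x}"
  shows "star_hom (Fr E) (leavitt_path_algebra E) \<pi>"
    and "\<pi> ` carrier (Fr E) = carrier (leavitt_path_algebra E)"
    and "\<lbrakk>x \<in> carrier (Fr E); y \<in> carrier (Fr E)\<rbrakk> \<Longrightarrow> \<pi> x = \<pi> y \<longleftrightarrow> x - y \<in> leavitt_ideal E"
proof -
  interpret star_congruence "Fr E" "leavitt_rel E"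
    by (rule leavitt_congruence)
  show "star_hom (Fr E) (leavitt_path_algebra E) \<pi>"
    unfolding \<pi>_def leavitt_path_algebra_def by (rule quot_star_hom)
  show "\<pi> ` carrier (Fr E) = carrier (leavitt_path_algebra E)"
    unfolding \<pi>_def leavitt_path_algebra_def by (auto simp: quot_class elim: quot_cases)
  show "\<pi> x = \<pi> y \<longleftrightarrow> x - y \<in> leavitt_ideal E" if "x \<in> carrier (Fr E)" "y \<in> carrier (Fr E)"
    using eq_equiv_class_iff[OF eqv that] that by (simp add: \<pi>_def leavitt_rel_def)
qed

theorem corollary4p5:
  fixes E :: "('v, 'e) pre_digraph" and F :: "('w, 'f) pre_digraph"
  assumes "countable_digraph E" and "countable_digraph F"
    and "star_isomorphic (leavitt_path_algebra E) (leavitt_path_algebra F)"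
  shows "star_isomorphic (graph_cstar_algebra E) (graph_cstar_algebra F)"
proof -
  have E: "wf_digraph E" and F: "wf_digraph F"
    using assms(1,2) by (simp_all add: countable_digraph_def)
  obtain \<phi> where \<phi>: "star_hom (leavitt_path_algebra E) (leavitt_path_algebra F) \<phi>"
    and bij: "bij_betw \<phi> (carrier (leavitt_path_algebra E)) (carrier (leavitt_path_algebra F))"
    using assms(3) by (auto simp: star_isomorphic_def)
  \<comment> \<open>The Leavitt path algebra of \<open>F\<close> is also presented as a quotient of
    the free algebra on \<open>E\<close>. Injectivity of \<open>\<phi>\<close> keeps the kernel
    equal to the Leavitt ideal of \<open>E\<close>, so both graph algebras are isomorphic to the
    same completion \<open>?U\<close>.\<close>
  let ?\<rho> = "\<lambda>x. \<phi> (leavitt_rel E `` {x})"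
  let ?U = "cstar_completion (leavitt_path_algebra F) (universal_norm (leavitt_path_algebra F))"
  have surj: "?\<rho> ` carrier (Fr E) = carrier (leavitt_path_algebra F)"
    using bij leavitt_quotient(2)[of E] unfolding bij_betw_def by (metis image_image)
  have "?\<rho> x = ?\<rho> y \<longleftrightarrow> x - y \<in> leavitt_ideal E"
    if "x \<in> carrier (Fr E)" "y \<in> carrier (Fr E)" for x y
    using leavitt_quotient(2)[of E] that
    by (subst inj_on_eq_iff[OF bij_betw_imp_inj_on[OF bij]]) (auto simp: leavitt_quotient(3))
  from graph_cstar_isomorphic_completion[OF E leavitt_path_star_algebra
      star_hom_comp[OF leavitt_quotient(1) \<phi>] surj this]
  have "star_isomorphic (graph_cstar_algebra E) ?U" .
  moreover have "star_isomorphic (graph_cstar_algebra F) ?U"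
    by (rule graph_cstar_isomorphic_completion[OF F leavitt_path_star_algebra leavitt_quotient])
  moreover have "star_algebra (graph_cstar_algebra F)"
    using graph_cstar_algebra[OF F] by (rule cstar_algebra.axioms)
  ultimately show ?thesis
    by (blast intro: star_isomorphic_trans star_isomorphic_sym)
qed

end
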